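(* There exist absolute constants $C, \varepsilon, n_0 > 0$ such that the following holds. If $L$ is a partial Latin square of order $n \geq n_0$ with $|L| \le \varepsilon n^2$, then $L$ has an embedding of order $n'$ for some $n' \leq n + C\sqrt{|L|}$.
   Context: A Latin square of order $n$ is an $n \times n$ matrix $M$ with entries in $[n]=\{1,\dots,n\}$ in which every element of $[n]$ appears exactly once in each row and each column. A partial Latin square of order $n$ is an $n \times n$ matrix $P$ with entries in $[n] \cup \{\ast\}$ (where $\ast$ stands for an empty cell) in which every element of $[n]$ appears at most once in every row and at most once in every column. $|P|$ denotes the number of non-empty cells of $P$, i.e. cells with $P_{i,j} \neq \ast$. Given a partial Latin square $P$ of order $n$ and a (complete) Latin square $M$ of order $n' \ge n$, $M$ is an embedding of $P$ (of order $n'$) if $M_{i,j} = P_{i,j}$ for all $1 \le i,j \le n$ with $P_{i,j} \neq \ast$. *)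

theory Defs
  imports Complex_Main
begin

(* An n x n matrix is a function of two indices of which only the values at
   row and column indices in {1..n} are relevant; values outside this range are
   unconstrained and ignored.  In a partial matrix, None is the empty cell. *)

definition latin_square :: "nat \<Rightarrow> (nat \<Rightarrow> nat \<Rightarrow> nat) \<Rightarrow> bool" where
  "latin_square n M \<longleftrightarrow>
     (\<forall>i\<in>{1..n}. \<forall>j\<in>{1..n}. M i j \<in> {1..n}) \<and>
     (\<forall>i\<in>{1..n}. \<forall>k\<in>{1..n}. \<exists>!j. j \<in> {1..n} \<and> M i j = k) \<and>
     (\<forall>j\<in>{1..n}. \<forall>k\<in>{1..n}. \<exists>!i. i \<in> {1..n} \<and> M i j = k)"

definition partial_latin_square :: "nat \<Rightarrow> (nat \<Rightarrow> nat \<Rightarrow> nat option) \<Rightarrow> bool" where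
  "partial_latin_square n P \<longleftrightarrow>
     (\<forall>i\<in>{1..n}. \<forall>j\<in>{1..n}. P i j \<in> insert None (Some ` {1..n})) \<and>
     (\<forall>i\<in>{1..n}. \<forall>k\<in>{1..n}. \<exists>\<^sub>\<le>\<^sub>1j. j \<in> {1..n} \<and> P i j = Some k) \<and>
     (\<forall>j\<in>{1..n}. \<forall>k\<in>{1..n}. \<exists>\<^sub>\<le>\<^sub>1i. i \<in> {1..n} \<and> P i j = Some k)"

definition num_filled :: "nat \<Rightarrow> (nat \<Rightarrow> nat \<Rightarrow> nat option) \<Rightarrow> nat" where
  "num_filled n P = card {(i, j). i \<in> {1..n} \<and> j \<in> {1..n} \<and> P i j \<noteq> None}"

definition is_embedding ::
  "nat \<Rightarrow> (nat \<Rightarrow> nat \<Rightarrow> nat option) \<Rightarrow> nat \<Rightarrow> (nat \<Rightarrow> nat \<Rightarrow> nat) \<Rightarrow> bool" where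
  "is_embedding n P n' M \<longleftrightarrow>
     n \<le> n' \<and> latin_square n' M \<and>
     (\<forall>i\<in>{1..n}. \<forall>j\<in>{1..n}. P i j \<noteq> None \<longrightarrow> P i j = Some (M i j))"

end

theory Submission
  imports Defs
begin

text \<open>
  Let \<open>m\<close> be the number of filled cells and \<open>s\<close> the least integer with \<open>m \<le> s\<^sup>2\<close>. By Ryser's theorem
  it is enough to fill a square of order \<open>n + 15 s\<close> that contains \<open>L\<close> with \<open>n + 25 s\<close> symbols so that
  every symbol is missing from at most \<open>10 s\<close> rows. Rows, columns and symbols with more than \<open>s\<close> cells
  in \<open>L\<close> are few: any two of different kinds first get a common cell with a new row, column or
  symbol, and then they are completed greedily inside the enlarged square, as are the few symbols
  with many more cells in \<open>L\<close> than the average. In the remaining cells every line forbids only \<open>O(s)\<close>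
  colours, so Galvin's list colouring theorem fills them. Finally the sizes of the colour classes are
  evened out by Kempe swaps that avoid the cells of \<open>L\<close>. If no swap helps a symbol \<open>b\<close> with a class
  that is too small, then every other class exceeds the required size by at most the number of cells
  of \<open>L\<close> in the two symbols involved; summing over all symbols contradicts the total number of cells.
\<close>

section \<open>Kempe chains and edge colouring\<close>

text \<open>For t = 10 s this allows only about 100 s^2 / n cells, which may be far below the s
  cells that the greedy steps tolerate. This is why a second family \<open>M\<close> of symbols has
  to be completed. It can have linear size, so it can neither be treated like the O(s) heavy lines
  nor be charged to the O(s) colours lost by a list. Neither matters: a full row or column already
  meets every symbol of \<open>M\<close>, and a completed symbol occurs in every row and column, so
  it lowers the degree of each line of the empty cells by one and costs each list only one colour.
  The constants: completing a heavy line greedily needs up to 14 s extra room, hence 15 s; a list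
  loses at most 4 s colours beyond the completed symbols, well within the surplus of 10 s; and (10
  s)^2 = 100 s^2 makes \<open>M\<close> a small fraction of all symbols.\<close>

definition proper :: "('a \<times> 'b) set \<Rightarrow> ('a \<times> 'b \<Rightarrow> 'c) \<Rightarrow> bool" where
  "proper E f \<longleftrightarrow>
     (\<forall>x y y'. (x, y) \<in> E \<longrightarrow> (x, y') \<in> E \<longrightarrow> f (x, y) = f (x, y') \<longrightarrow> y = y') \<and>
     (\<forall>x x' y. (x, y) \<in> E \<longrightarrow> (x', y) \<in> E \<longrightarrow> f (x, y) = f (x', y) \<longrightarrow> x = x')"

lemma properI:
  assumes "\<And>x y y'. (x, y) \<in> E \<Longrightarrow> (x, y') \<in> E \<Longrightarrow> f (x, y) = f (x, y') \<Longrightarrow> y = y'"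
    and "\<And>x x' y. (x, y) \<in> E \<Longrightarrow> (x', y) \<in> E \<Longrightarrow> f (x, y) = f (x', y) \<Longrightarrow> x = x'"
  shows "proper E f"
  unfolding proper_def using assms by blast

lemma proper_row:
  "proper E f \<Longrightarrow> (x, y) \<in> E \<Longrightarrow> (x, y') \<in> E \<Longrightarrow> f (x, y) = f (x, y') \<Longrightarrow> y = y'"
  unfolding proper_def by blast

lemma proper_col:
  "proper E f \<Longrightarrow> (x, y) \<in> E \<Longrightarrow> (x', y) \<in> E \<Longrightarrow> f (x, y) = f (x', y) \<Longrightarrow> x = x'"
  unfolding proper_def by blast

text \<open>The alternating path is followed in one direction only: a column is left by its
  \<open>a\<close>-edge and the next one entered by a \<open>b\<close>-edge. From a column without
  \<open>b\<close> the forward closure already reaches all columns of the component, so these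
  columns alone describe the chain.\<close>

definition kempe_step :: "('a \<times> 'b) set \<Rightarrow> ('a \<times> 'b \<Rightarrow> 'c) \<Rightarrow> 'c \<Rightarrow> 'c \<Rightarrow> ('b \<times> 'b) set" where
  "kempe_step E f a b =
     {(y, y'). \<exists>x. (x, y) \<in> E \<and> (x, y') \<in> E \<and> f (x, y) = a \<and> f (x, y') = b}"

definition kempe_cols :: "('a \<times> 'b) set \<Rightarrow> ('a \<times> 'b \<Rightarrow> 'c) \<Rightarrow> 'c \<Rightarrow> 'c \<Rightarrow> 'b \<Rightarrow> 'b set" where
  "kempe_cols E f a b y0 = (kempe_step E f a b)\<^sup>* `` {y0}"

definition swap_cols :: "'c \<Rightarrow> 'c \<Rightarrow> 'b set \<Rightarrow> ('a \<times> 'b \<Rightarrow> 'c) \<Rightarrow> 'a \<times> 'b \<Rightarrow> 'c" where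
  "swap_cols a b X f = (\<lambda>e. if snd e \<in> X then (if f e = a then b else if f e = b then a else f e)
                            else f e)"

lemma kempe_cols_start: "y0 \<in> kempe_cols E f a b y0"
  by (simp add: kempe_cols_def)

lemma kempe_cols_step:
  assumes "y \<in> kempe_cols E f a b y0" "(x, y) \<in> E" "(x, y') \<in> E" "f (x, y) = a" "f (x, y') = b"
  shows "y' \<in> kempe_cols E f a b y0"
proof -
  have "(y, y') \<in> kempe_step E f a b" using assms(2-5) unfolding kempe_step_def by blast
  then show ?thesis using assms(1) unfolding kempe_cols_def by (auto intro: rtrancl_into_rtrancl)
qed

lemma kempe_cols_back:
  assumes "y \<in> kempe_cols E f a b y0" "y \<noteq> y0"
  obtains x y' where "y' \<in> kempe_cols E f a b y0" "(x, y') \<in> E" "(x, y) \<in> E"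
    "f (x, y') = a" "f (x, y) = b"
proof -
  have "(y0, y) \<in> (kempe_step E f a b)\<^sup>*" using assms(1) by (simp add: kempe_cols_def)
  then obtain y' where "(y0, y') \<in> (kempe_step E f a b)\<^sup>*" "(y', y) \<in> kempe_step E f a b"
    using assms(2) by (metis rtranclE)
  then show ?thesis using that unfolding kempe_cols_def kempe_step_def by blast
qed

text \<open>A clash could only arise in a row, between a chain column and a column outside. An
  \<open>a\<close>-edge at a chain column leads forward to the \<open>b\<close>-edge of its row,
  again in the chain. A \<open>b\<close>-edge at a chain column lies in the row by which that column
  was entered, as the start has no \<open>b\<close>; so the \<open>a\<close>-edge of that row is in
  the chain too.\<close>

lemma proper_swap_cols:
  assumes f: "proper E f" and y0: "\<And>x. (x, y0) \<in> E \<Longrightarrow> f (x, y0) \<noteq> b"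
  shows "proper E (swap_cols a b (kempe_cols E f a b y0) f)"
proof -
  let ?X = "kempe_cols E f a b y0"
  have sep: "f (x, y) \<noteq> (if f (x, y') = a then b else if f (x, y') = b then a else f (x, y'))"
    if e: "(x, y) \<in> E" "(x, y') \<in> E" "y \<notin> ?X" "y' \<in> ?X" for x y y'
  proof
    assume eq: "f (x, y) = (if f (x, y') = a then b else if f (x, y') = b then a else f (x, y'))"
    show False
    proof (cases "f (x, y') = a")
      case True
      then show False using eq e kempe_cols_step[OF e(4) e(2) e(1)] by simp
    next
      case False
      show False
      proof (cases "f (x, y') = b")
        case True
        then have "y' \<noteq> y0" using y0 e by blast
        then obtain x' y'' where *: "y'' \<in> ?X" "(x', y'') \<in> E" "(x', y') \<in> E"
          "f (x', y'') = a" "f (x', y') = b"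
          using kempe_cols_back[OF e(4)] by blast
        have "x' = x" using proper_col[OF f *(3) e(2)] * True by simp
        then have "y'' = y" using proper_row[OF f _ e(1)] * eq True False by auto
        then show False using * e by simp
      next
        case F2: False
        then have "y = y'" using eq False proper_row[OF f e(1) e(2)] by simp
        then show False using e by simp
      qed
    qed
  qed
  show ?thesis
  proof (rule properI)
    fix x y y'
    assume e: "(x, y) \<in> E" "(x, y') \<in> E"
      and eq: "swap_cols a b ?X f (x, y) = swap_cols a b ?X f (x, y')"
    show "y = y'"
      using eq sep[OF e] sep[OF e(2) e(1)] proper_row[OF f e]
      unfolding swap_cols_def by (auto split: if_splits)
  next
    fix x x' y
    assume e: "(x, y) \<in> E" "(x', y) \<in> E"
      and eq: "swap_cols a b ?X f (x, y) = swap_cols a b ?X f (x', y)"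
    show "x = x'"
      using eq proper_col[OF f e] unfolding swap_cols_def by (auto split: if_splits)
  qed
qed

text \<open>Predecessors along a chain are unique, so if two chains share a column, one start is
  reached from the other. A column without \<open>b\<close> has no predecessor, which forces the
  starts to coincide.\<close>

lemma kempe_cols_disjoint:
  assumes f: "proper E f"
    and y0: "\<And>x. (x, y0) \<in> E \<Longrightarrow> f (x, y0) \<noteq> b" and y1: "\<And>x. (x, y1) \<in> E \<Longrightarrow> f (x, y1) \<noteq> b"
    and y: "y \<in> kempe_cols E f a b y0" "y \<in> kempe_cols E f a b y1"
  shows "y0 = y1"
proof -
  let ?S = "kempe_step E f a b"
  have sv: "single_valued (?S\<inverse>)"
  proof (rule single_valuedI)
    fix u v w assume "(u, v) \<in> ?S\<inverse>" "(u, w) \<in> ?S\<inverse>"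
    then obtain x x' where *: "(x, v) \<in> E" "(x, u) \<in> E" "f (x, v) = a" "f (x, u) = b"
      "(x', w) \<in> E" "(x', u) \<in> E" "f (x', w) = a" "f (x', u) = b"
      unfolding kempe_step_def by blast
    then have "x = x'" using proper_col[OF f *(2) *(6)] by simp
    then show "v = w" using proper_row[OF f *(1)] * by simp
  qed
  have "(y, y0) \<in> (?S\<inverse>)\<^sup>*" "(y, y1) \<in> (?S\<inverse>)\<^sup>*"
    using y unfolding kempe_cols_def rtrancl_converse by blast+
  from single_valued_confluent[OF sv this]
  have "(y0, y1) \<in> (?S\<inverse>)\<^sup>* \<or> (y1, y0) \<in> (?S\<inverse>)\<^sup>*" .
  moreover have "z = w" if "(z, w) \<in> (?S\<inverse>)\<^sup>*" "\<And>x. (x, z) \<in> E \<Longrightarrow> f (x, z) \<noteq> b" for z w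
    using that(1)
  proof (cases rule: converse_rtranclE)
    case (step u)
    then show ?thesis using that(2) unfolding kempe_step_def by blast
  qed simp
  ultimately show ?thesis using y0 y1 by (elim disjE) (blast, metis)
qed

section \<open>Koenig's edge colouring theorem\<close>

lemma exists_unused_colour:
  assumes "finite F" "card F < d"
  shows "\<exists>c<d. c \<notin> f ` F"
proof (rule ccontr)
  assume "\<not> ?thesis"
  then have "{..<d} \<subseteq> f ` F" by auto
  then have "d \<le> card (f ` F)" using card_mono[of "f ` F" "{..<d}"] assms by simp
  then show False using card_image_le[OF assms(1), of f] assms by simp
qed

lemma finite_slices:
  assumes "finite E"
  shows "finite {y. (x, y) \<in> E}" "finite {x. (x, y) \<in> E}"
proof -
  have "{y. (x, y) \<in> E} = E `` {x}" "{x. (x, y) \<in> E} = E\<inverse> `` {y}" by auto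
  then show "finite {y. (x, y) \<in> E}" "finite {x. (x, y) \<in> E}"
    using assms by (simp_all add: finite_Image)
qed

text \<open>The new edge joins a row \<open>r\<close> lacking \<open>a\<close> to a column
  \<open>c\<close> lacking \<open>b\<close>. Swapping the chain from \<open>c\<close> frees
  \<open>a\<close> at \<open>c\<close> and cannot put \<open>a\<close> into row \<open>r\<close>,
  because the chain enters a row only by an \<open>a\<close>-edge.\<close>

theorem koenig_edge_colouring:
  assumes "finite E" "\<And>x. card {y. (x, y) \<in> E} \<le> d" "\<And>y. card {x. (x, y) \<in> E} \<le> d"
  shows "\<exists>f. proper E f \<and> (\<forall>e\<in>E. f e < d)"
  using assms
proof (induction E rule: finite_induct)
  case empty
  show ?case by (simp add: proper_def)
next
  case (insert e E)
  obtain r c where e: "e = (r, c)" by fastforce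
  let ?E = "insert e E"
  note fin = finite_slices[OF insert.hyps(1)]
  have "finite ?E" using insert.hyps(1) by simp
  note fin' = finite_slices[OF this]
  have sub: "{y. (x, y) \<in> E} \<subseteq> {y. (x, y) \<in> ?E}" "{x. (x, y) \<in> E} \<subseteq> {x. (x, y) \<in> ?E}" for x y
    by auto
  have "card {y. (x, y) \<in> E} \<le> d" for x
    by (rule order_trans[OF card_mono[OF fin'(1) sub(1)] insert.prems(1)])
  moreover have "card {x. (x, y) \<in> E} \<le> d" for y
    by (rule order_trans[OF card_mono[OF fin'(2) sub(2)] insert.prems(2)])
  ultimately obtain f where f: "proper E f" "\<forall>e\<in>E. f e < d" using insert.IH by blast
  have "{y. (r, y) \<in> E} \<subset> {y. (r, y) \<in> ?E}" "{x. (x, c) \<in> E} \<subset> {x. (x, c) \<in> ?E}"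
    using e insert.hyps(2) by auto
  note less = less_le_trans[OF psubset_card_mono[OF fin'(1) this(1)] insert.prems(1)]
    less_le_trans[OF psubset_card_mono[OF fin'(2) this(2)] insert.prems(2)]
  obtain a where "a < d" "a \<notin> (\<lambda>y. f (r, y)) ` {y. (r, y) \<in> E}"
    using exists_unused_colour[OF fin(1) less(1)] by metis
  then have a: "a < d" "\<And>y. (r, y) \<in> E \<Longrightarrow> f (r, y) \<noteq> a" by auto
  obtain b where "b < d" "b \<notin> (\<lambda>x. f (x, c)) ` {x. (x, c) \<in> E}"
    using exists_unused_colour[OF fin(2) less(2)] by metis
  then have b: "b < d" "\<And>x. (x, c) \<in> E \<Longrightarrow> f (x, c) \<noteq> b" by auto
  let ?X = "kempe_cols E f a b c"
  define g where "g = swap_cols a b ?X f"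
  have g: "proper E g" unfolding g_def by (rule proper_swap_cols[OF f(1) b(2)])
  have gc: "g (x, c) \<noteq> a" if "(x, c) \<in> E" for x
    using b(2)[OF that] kempe_cols_start[of c] unfolding g_def swap_cols_def by auto
  have gr: "g (r, y) \<noteq> a" if "(r, y) \<in> E" for y
  proof
    assume "g (r, y) = a"
    then have y: "y \<in> ?X" "f (r, y) = b"
      using a(2)[OF that] unfolding g_def swap_cols_def by (auto split: if_splits)
    then have "y \<noteq> c" using b(2) that by blast
    then obtain x y' where *: "(x, y') \<in> E" "(x, y) \<in> E" "f (x, y') = a" "f (x, y) = b"
      using kempe_cols_back[OF y(1)] by metis
    then have "x = r" using proper_col[OF f(1) *(2) that] y by simp
    then show False using a(2) * by blast
  qed
  have "proper ?E (g(e := a))"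
  proof (rule properI)
    fix x y y'
    assume "(x, y) \<in> ?E" "(x, y') \<in> ?E" "(g(e := a)) (x, y) = (g(e := a)) (x, y')"
    then show "y = y'" using gr proper_row[OF g, of x y y'] unfolding e by (auto split: if_splits)
  next
    fix x x' y
    assume "(x, y) \<in> ?E" "(x', y) \<in> ?E" "(g(e := a)) (x, y) = (g(e := a)) (x', y)"
    then show "x = x'" using gc proper_col[OF g, of x y x'] unfolding e by (auto split: if_splits)
  qed
  moreover have "(g(e := a)) e' < d" if "e' \<in> ?E" for e'
    using f(2) a b that unfolding g_def swap_cols_def by auto
  ultimately show ?case by blast
qed

section \<open>Galvin's list colouring theorem\<close>

text \<open>
  If the largest colours of the rows lie in distinct columns, they form the kernel. Otherwise two of
  them share a column, and the larger one can be left out: whatever absorbs the smaller one in a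
  kernel of the rest also absorbs the larger one.
\<close>

lemma edge_kernel:
  fixes c :: "'a \<times> 'b \<Rightarrow> nat"
  assumes "finite E" "proper E c"
  shows "\<exists>K\<subseteq>E. (\<forall>x y y'. (x, y) \<in> K \<longrightarrow> (x, y') \<in> K \<longrightarrow> y = y') \<and>
    (\<forall>x x' y. (x, y) \<in> K \<longrightarrow> (x', y) \<in> K \<longrightarrow> x = x') \<and>
    (\<forall>x y. (x, y) \<in> E - K \<longrightarrow>
      (\<exists>y'. (x, y') \<in> K \<and> c (x, y) < c (x, y')) \<or> (\<exists>x'. (x', y) \<in> K \<and> c (x', y) < c (x, y)))"
  using assms
proof (induction E rule: finite_psubset_induct)
  case (psubset E)
  define T where "T = {(x, y) \<in> E. \<forall>y'. (x, y') \<in> E \<longrightarrow> c (x, y') \<le> c (x, y)}"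
  have T: "(x, y) \<in> T \<longleftrightarrow> (x, y) \<in> E \<and> (\<forall>y'. (x, y') \<in> E \<longrightarrow> c (x, y') \<le> c (x, y))" for x y
    by (simp add: T_def)
  have rowinj: "y = y'" if "(x, y) \<in> T" "(x, y') \<in> T" for x y y'
    using that proper_row[OF psubset.prems, of x y y'] unfolding T by (auto intro: le_antisym)
  show ?case
  proof (cases "\<forall>x x' y. (x, y) \<in> T \<longrightarrow> (x', y) \<in> T \<longrightarrow> x = x'")
    case True
    have absorb: "\<exists>y'. (x, y') \<in> T \<and> c (x, y) < c (x, y')" if xy: "(x, y) \<in> E - T" for x y
    proof -
      let ?R = "{y. (x, y) \<in> E}"
      have R: "finite ?R" "y \<in> ?R" using finite_slices(1)[OF psubset.hyps(1)] xy by auto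
      then have "Max ((\<lambda>y. c (x, y)) ` ?R) \<in> (\<lambda>y. c (x, y)) ` ?R"
        by (intro Max_in) auto
      then obtain y' where y': "(x, y') \<in> E" "c (x, y') = Max ((\<lambda>y. c (x, y)) ` ?R)" by auto
      then have "(x, y') \<in> T" using R unfolding T by auto
      moreover have "c (x, y) < c (x, y')"
      proof -
        obtain y'' where "(x, y'') \<in> E" "c (x, y) < c (x, y'')" using xy T by (auto simp: not_le)
        then show ?thesis using y' R by (metis (mono_tags, lifting) Max_ge finite_imageI image_eqI
          less_le_trans mem_Collect_eq)
      qed
      ultimately show ?thesis by blast
    qed
    show ?thesis
    proof (intro exI[of _ T] conjI allI impI)
      show "T \<subseteq> E" unfolding T_def by blast
      show "y = y'" if "(x, y) \<in> T" "(x, y') \<in> T" for x y y' using rowinj that .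
      show "x = x'" if "(x, y) \<in> T" "(x', y) \<in> T" for x x' y by (rule True[rule_format, OF that])
      show "(\<exists>y'. (x, y') \<in> T \<and> c (x, y) < c (x, y')) \<or> (\<exists>x'. (x', y) \<in> T \<and> c (x', y) < c (x, y))"
        if "(x, y) \<in> E - T" for x y using absorb[OF that] ..
    qed
  next
    case False
    then obtain u v y where uv: "(u, y) \<in> T" "(v, y) \<in> T" "u \<noteq> v" by blast
    have "c (u, y) \<noteq> c (v, y)" using proper_col[OF psubset.prems, of u y v] uv T by auto
    then obtain x1 x2 where x12: "(x1, y) \<in> T" "(x2, y) \<in> T" "c (x1, y) < c (x2, y)"
      using uv by (metis linorder_neqE_nat)
    have "E - {(x2, y)} \<subset> E" using x12 T by auto
    moreover have "proper (E - {(x2, y)}) c" using psubset.prems unfolding proper_def by blast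
    ultimately obtain K where K: "K \<subseteq> E - {(x2, y)}"
      "\<forall>x y y'. (x, y) \<in> K \<longrightarrow> (x, y') \<in> K \<longrightarrow> y = y'"
      "\<forall>x x' y. (x, y) \<in> K \<longrightarrow> (x', y) \<in> K \<longrightarrow> x = x'"
      "\<And>x z. (x, z) \<in> E - {(x2, y)} - K \<Longrightarrow> (\<exists>y'. (x, y') \<in> K \<and> c (x, z) < c (x, y')) \<or>
        (\<exists>x'. (x', z) \<in> K \<and> c (x', z) < c (x, z))"
    proof -
      assume "E - {(x2, y)} \<subset> E" "proper (E - {(x2, y)}) c"
      from psubset.IH[OF this] show thesis
        by (elim exE conjE) (rule that, assumption+, metis)
    qed
    have "\<exists>x'. (x', y) \<in> K \<and> c (x', y) < c (x2, y)"
    proof (cases "(x1, y) \<in> K")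
      case True
      then show ?thesis using x12 by blast
    next
      case False
      then have "(x1, y) \<in> E - {(x2, y)} - K" using x12 T by auto
      \<comment> \<open>The cell (x1, y) has the largest colour of its row, so only its column can
        absorb it. The absorbing cell then lies in the column of (x2, y) and has an even smaller
        colour than (x2, y).\<close>
      moreover have "\<not> c (x1, y) < c (x1, y')" if "(x1, y') \<in> K" for y'
        using x12(1) that K(1) unfolding T by (auto simp: not_less)
      ultimately show ?thesis using K(4) x12(3) by (meson less_trans)
    qed
    then have "\<forall>x z. (x, z) \<in> E - K \<longrightarrow> (\<exists>y'. (x, y') \<in> K \<and> c (x, z) < c (x, y')) \<or>
        (\<exists>x'. (x', z) \<in> K \<and> c (x', z) < c (x, z))" using K(4) by blast
    moreover have "K \<subseteq> E" using K(1) by blast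
    ultimately show ?thesis using K(2,3) by (intro exI[of _ K]) simp
  qed
qed

text \<open>The out-degree in Galvin's orientation of the line graph: towards larger colours within
  a row, towards smaller ones within a column.\<close>

definition galvin_weight :: "('a \<times> 'b) set \<Rightarrow> ('a \<times> 'b \<Rightarrow> nat) \<Rightarrow> 'a \<Rightarrow> 'b \<Rightarrow> nat" where
  "galvin_weight E c x y = card {y'. (x, y') \<in> E \<and> c (x, y) < c (x, y')} +
     card {x'. (x', y) \<in> E \<and> c (x', y) < c (x, y)}"

text \<open>A colour \<open>k\<close> is given to a kernel of the cells whose list contains
  \<open>k\<close>. Any other such cell loses \<open>k\<close> from its list, but also loses an
  out-neighbour in the kernel, so lists stay larger than weights.\<close>

lemma list_colouring_of_weights:
  fixes c :: "'a \<times> 'b \<Rightarrow> nat" and S :: "'a \<times> 'b \<Rightarrow> 'c set"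
  assumes "finite E" "proper E c"
    and "\<And>x y. (x, y) \<in> E \<Longrightarrow> finite (S (x, y)) \<and> galvin_weight E c x y < card (S (x, y))"
  shows "\<exists>f. proper E f \<and> (\<forall>e\<in>E. f e \<in> S e)"
  using assms
proof (induction E arbitrary: S rule: finite_psubset_induct)
  case (psubset E)
  have fin: "finite {y'. (x, y') \<in> E \<and> P y'}" "finite {x'. (x', y) \<in> E \<and> Q x'}" for x y P Q
    using finite_slices[OF psubset.hyps(1)] by simp_all
  show ?case
  proof (cases "E = {}")
    case True
    then show ?thesis by (simp add: proper_def)
  next
    case False
    then obtain x0 y0 where e0: "(x0, y0) \<in> E" by auto
    then have "S (x0, y0) \<noteq> {}" using psubset.prems(2)[OF e0] by auto
    then obtain k where k: "k \<in> S (x0, y0)" by blast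
    define F where "F = {e \<in> E. k \<in> S e}"
    have "finite F" "proper F c"
      using psubset.hyps(1) psubset.prems(1) unfolding F_def proper_def by auto
    from edge_kernel[OF this] obtain K where K: "K \<subseteq> F"
      "\<And>x y y'. (x, y) \<in> K \<Longrightarrow> (x, y') \<in> K \<Longrightarrow> y = y'"
      "\<And>x x' y. (x, y) \<in> K \<Longrightarrow> (x', y) \<in> K \<Longrightarrow> x = x'"
      "\<And>x y. (x, y) \<in> F - K \<Longrightarrow> (\<exists>y'. (x, y') \<in> K \<and> c (x, y) < c (x, y')) \<or>
        (\<exists>x'. (x', y) \<in> K \<and> c (x', y) < c (x, y))" by metis
    have "K \<noteq> {}" using K(4)[of x0 y0] e0 k unfolding F_def by blast
    then have "E - K \<subset> E" using K(1) unfolding F_def by blast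
    moreover have "proper (E - K) c" using psubset.prems(1) unfolding proper_def by blast
    moreover have "finite (S (x, y) - {k}) \<and> galvin_weight (E - K) c x y < card (S (x, y) - {k})"
      if e: "(x, y) \<in> E - K" for x y
    proof -
      let ?R = "\<lambda>E. {y'. (x, y') \<in> E \<and> c (x, y) < c (x, y')}"
      let ?C = "\<lambda>E. {x'. (x', y) \<in> E \<and> c (x', y) < c (x, y)}"
      have le: "card (?R (E - K)) \<le> card (?R E)" "card (?C (E - K)) \<le> card (?C E)"
        by (intro card_mono fin; blast)+
      have S: "finite (S (x, y))" "galvin_weight E c x y < card (S (x, y))"
        using psubset.prems(2) e by auto
      show ?thesis
      proof (cases "k \<in> S (x, y)")
        case False
        then show ?thesis using S le unfolding galvin_weight_def by simp
      next
        case True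
        then have "(x, y) \<in> F - K" using e unfolding F_def by blast
        have sub: "?R (E - K) \<subseteq> ?R E" "?C (E - K) \<subseteq> ?C E" by blast+
        from K(4)[OF \<open>(x, y) \<in> F - K\<close>]
        have "?R (E - K) \<subset> ?R E \<or> ?C (E - K) \<subset> ?C E"
        proof (elim disjE exE)
          fix y' assume y': "(x, y') \<in> K \<and> c (x, y) < c (x, y')"
          then have "y' \<in> ?R E" "y' \<notin> ?R (E - K)" using K(1) unfolding F_def by auto
          then have "?R (E - K) \<noteq> ?R E" by blast
          then show ?thesis using sub(1) by (simp only: psubset_eq simp_thms)
        next
          fix x' assume x': "(x', y) \<in> K \<and> c (x', y) < c (x, y)"
          then have "x' \<in> ?C E" "x' \<notin> ?C (E - K)" using K(1) unfolding F_def by auto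
          then have "?C (E - K) \<noteq> ?C E" by blast
          then show ?thesis using sub(2) by (simp only: psubset_eq simp_thms)
        qed
        then have "card (?R (E - K)) < card (?R E) \<or> card (?C (E - K)) < card (?C E)"
          using psubset_card_mono[OF fin(1), of "?R (E - K)"] psubset_card_mono[OF fin(2), of "?C (E - K)"]
          by (elim disjE) simp_all
        then show ?thesis using S le True unfolding galvin_weight_def by auto
      qed
    qed
    ultimately have "\<exists>f. proper (E - K) f \<and> (\<forall>e\<in>E - K. f e \<in> S e - {k})"
      by (intro psubset.IH) auto
    then obtain f where f: "proper (E - K) f" "\<And>e. e \<in> E - K \<Longrightarrow> f e \<in> S e - {k}" by blast
    define g where "g = (\<lambda>e. if e \<in> K then k else f e)"
    have "proper E g"
    proof (rule properI)
      fix x y y'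
      assume "(x, y) \<in> E" "(x, y') \<in> E" "g (x, y) = g (x, y')"
      then show "y = y'" using K(2)[of x y y'] f(2)[of "(x, y)"] f(2)[of "(x, y')"]
        proper_row[OF f(1), of x y y'] unfolding g_def by (auto split: if_splits)
    next
      fix x x' y
      assume "(x, y) \<in> E" "(x', y) \<in> E" "g (x, y) = g (x', y)"
      then show "x = x'" using K(3)[of x y x'] f(2)[of "(x, y)"] f(2)[of "(x', y)"]
        proper_col[OF f(1), of x y x'] unfolding g_def by (auto split: if_splits)
    qed
    moreover have "\<forall>e\<in>E. g e \<in> S e" using f(2) K(1) unfolding g_def F_def by auto
    ultimately show ?thesis by blast
  qed
qed

text \<open>With a proper colouring by \<open>d\<close> colours, the row part of the weight counts
  distinct colours above that of the cell and the column part distinct colours below it, in total at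
  most d - 1.\<close>

theorem galvin_list_colouring:
  assumes "finite E" "\<And>x. card {y. (x, y) \<in> E} \<le> d" "\<And>y. card {x. (x, y) \<in> E} \<le> d"
    and S: "\<And>e. e \<in> E \<Longrightarrow> finite (S e) \<and> d \<le> card (S e)"
  shows "\<exists>f. proper E f \<and> (\<forall>e\<in>E. f e \<in> S e)"
proof -
  obtain c where c: "proper E c" "\<And>e. e \<in> E \<Longrightarrow> c e < d"
    using koenig_edge_colouring[OF assms(1-3)] by blast
  have "galvin_weight E c x y < d" if e: "(x, y) \<in> E" for x y
  proof -
    let ?R = "{y'. (x, y') \<in> E \<and> c (x, y) < c (x, y')}"
    let ?C = "{x'. (x', y) \<in> E \<and> c (x', y) < c (x, y)}"
    have "card ?R \<le> card {c (x, y)<..<d}"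
      by (rule card_inj_on_le[of "\<lambda>y'. c (x, y')"])
        (auto intro!: inj_onI intro: proper_row[OF c(1)] c(2))
    moreover have "card ?C \<le> card {..<c (x, y)}"
      by (rule card_inj_on_le[of "\<lambda>x'. c (x', y)"])
        (auto intro!: inj_onI intro: proper_col[OF c(1)])
    ultimately show ?thesis using c(2)[OF e] unfolding galvin_weight_def by simp
  qed
  then show ?thesis using S by (intro list_colouring_of_weights[OF assms(1) c(1)])
    (meson less_le_trans)
qed

section \<open>Balancing colour classes and Ryser's theorem\<close>

definition colour_cols :: "('a \<times> 'b) set \<Rightarrow> ('a \<times> 'b \<Rightarrow> 'c) \<Rightarrow> 'c \<Rightarrow> 'b set" where
  "colour_cols E f c = {y. \<exists>x. (x, y) \<in> E \<and> f (x, y) = c}"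

text \<open>The chain has \<open>a\<close> in every column by the assumption \<open>X\<close>, and
  \<open>b\<close> in every column but its start. Exchanging the colours thus changes the two column
  sets at \<open>y0\<close> only: exactly one cell passes from \<open>a\<close> to
  \<open>b\<close>.\<close>

lemma colour_cols_swap:
  assumes f: "proper E f" and ab: "a \<noteq> b" and y0: "y0 \<notin> colour_cols E f b"
    and X: "kempe_cols E f a b y0 \<subseteq> colour_cols E f a"
  defines "g \<equiv> swap_cols a b (kempe_cols E f a b y0) f"
  shows "colour_cols E g a = colour_cols E f a - {y0}"
    and "colour_cols E g b = insert y0 (colour_cols E f b)"
    and "c \<noteq> a \<Longrightarrow> c \<noteq> b \<Longrightarrow> colour_cols E g c = colour_cols E f c"
proof -
  let ?X = "kempe_cols E f a b y0"
  have y0X: "y0 \<in> ?X" by (rule kempe_cols_start)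
  have Xb: "y \<in> colour_cols E f b" if y: "y \<in> ?X" "y \<noteq> y0" for y
    using kempe_cols_back[OF y] unfolding colour_cols_def by blast
  have g: "g (x, y) = (if y \<in> ?X then (if f (x, y) = a then b else if f (x, y) = b then a else f (x, y))
      else f (x, y))" for x y by (simp add: g_def swap_cols_def)
  have "y \<in> colour_cols E g a \<longleftrightarrow> y \<in> (if y \<in> ?X then colour_cols E f b else colour_cols E f a)" for y
    using ab unfolding colour_cols_def g by (auto split: if_splits)
  moreover have "y \<in> (if y \<in> ?X then colour_cols E f b else colour_cols E f a) \<longleftrightarrow>
      y \<in> colour_cols E f a - {y0}" for y
    using y0X y0 X Xb[of y] by (cases "y = y0"; cases "y \<in> ?X") auto
  ultimately show "colour_cols E g a = colour_cols E f a - {y0}" by blast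
  have "y \<in> colour_cols E g b \<longleftrightarrow> y \<in> (if y \<in> ?X then colour_cols E f a else colour_cols E f b)" for y
    using ab unfolding colour_cols_def g by (auto split: if_splits)
  moreover have "y \<in> (if y \<in> ?X then colour_cols E f a else colour_cols E f b) \<longleftrightarrow>
      y \<in> insert y0 (colour_cols E f b)" for y
    using y0X y0 X Xb[of y] by (cases "y = y0"; cases "y \<in> ?X") auto
  ultimately show "colour_cols E g b = insert y0 (colour_cols E f b)" by blast
  show "colour_cols E g c = colour_cols E f c" if "c \<noteq> a" "c \<noteq> b"
    using that unfolding colour_cols_def g by (auto split: if_splits)
qed

text \<open>
  The Kempe components started at the columns without colour \<open>b\<close> are disjoint, so one of them
  avoids the columns without \<open>a\<close> and the columns where a cell of \<open>L\<close> has colour \<open>a\<close> or \<open>b\<close>.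
\<close>

lemma transfer_colour:
  assumes fin: "finite Y" "finite L" and E: "E \<subseteq> X \<times> Y" and LE: "L \<subseteq> E" and f: "proper E f"
    and lt: "card (colour_cols E f b) + card {e \<in> L. f e = a} + card {e \<in> L. f e = b}
      < card (colour_cols E f a)"
  obtains g y0 where "proper E g" "\<And>e. e \<in> L \<Longrightarrow> g e = f e"
    "\<And>e. g e = f e \<or> g e = a \<or> g e = b"
    "y0 \<in> colour_cols E f a" "y0 \<notin> colour_cols E f b"
    "colour_cols E g a = colour_cols E f a - {y0}"
    "colour_cols E g b = insert y0 (colour_cols E f b)"
    "\<And>c. c \<noteq> a \<Longrightarrow> c \<noteq> b \<Longrightarrow> colour_cols E g c = colour_cols E f c"
proof -
  have ab: "a \<noteq> b" using lt by auto
  have sub: "colour_cols E f c \<subseteq> Y" for c using E unfolding colour_cols_def by auto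
  define D where "D = Y - colour_cols E f b"
  \<comment> \<open>A chain through the first set would end in a column and bring \<open>b\<close>
    no gain; a chain through the other two would recolour a cell of \<open>L\<close>.\<close>
  define W where "W = (Y - colour_cols E f a) \<union> snd ` {e \<in> L. f e = a} \<union> snd ` {e \<in> L. f e = b}"
  have finW: "finite W" using fin unfolding W_def by simp
  have leY: "card (colour_cols E f c) \<le> card Y" for c by (rule card_mono[OF fin(1) sub])
  have cY: "card (Y - colour_cols E f c) = card Y - card (colour_cols E f c)" for c
    by (rule card_Diff_subset[OF finite_subset[OF sub fin(1)] sub])
  have "card W \<le> card (Y - colour_cols E f a) + card (snd ` {e \<in> L. f e = a})
      + card (snd ` {e \<in> L. f e = b})"
    unfolding W_def by (intro order_trans[OF card_Un_le] add_mono card_Un_le order_refl)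
  also have "\<dots> \<le> card (Y - colour_cols E f a) + card {e \<in> L. f e = a} + card {e \<in> L. f e = b}"
    using fin(2) by (intro add_mono card_image_le order_refl) simp_all
  also have "\<dots> < card D"
    using lt leY[of a] leY[of b] unfolding D_def cY by linarith
  finally have WD: "card W < card D" .
  have "\<exists>y0\<in>D. kempe_cols E f a b y0 \<inter> W = {}"
  proof (rule ccontr)
    assume "\<not> ?thesis"
    then have "\<forall>y0\<in>D. \<exists>w. w \<in> kempe_cols E f a b y0 \<and> w \<in> W" by blast
    then obtain w where w: "\<And>y0. y0 \<in> D \<Longrightarrow> w y0 \<in> kempe_cols E f a b y0 \<and> w y0 \<in> W" by metis
    have "inj_on w D"
    proof (rule inj_onI)
      fix u v assume uv: "u \<in> D" "v \<in> D" "w u = w v"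
      show "u = v"
      proof (rule kempe_cols_disjoint[OF f])
        show "w u \<in> kempe_cols E f a b u" "w u \<in> kempe_cols E f a b v" using w uv by metis+
        show "\<And>x. (x, u) \<in> E \<Longrightarrow> f (x, u) \<noteq> b" "\<And>x. (x, v) \<in> E \<Longrightarrow> f (x, v) \<noteq> b"
          using uv(1,2) unfolding D_def colour_cols_def by blast+
      qed
    qed
    moreover have "w ` D \<subseteq> W" using w by blast
    ultimately have "card D \<le> card W" using card_inj_on_le finW by blast
    then show False using WD by simp
  qed
  then obtain y0 where y0: "y0 \<in> D" "kempe_cols E f a b y0 \<inter> W = {}" by blast
  let ?X = "kempe_cols E f a b y0"
  have XY: "?X \<subseteq> Y"
  proof
    fix y assume y: "y \<in> ?X"
    show "y \<in> Y"
    proof (cases "y = y0")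
      case True then show ?thesis using y0 unfolding D_def by simp
    next
      case False then show ?thesis using kempe_cols_back[OF y False] E by blast
    qed
  qed
  then have Xa: "?X \<subseteq> colour_cols E f a" using y0(2) unfolding W_def by blast
  have y0b: "y0 \<notin> colour_cols E f b" using y0(1) unfolding D_def by blast
  let ?g = "swap_cols a b ?X f"
  show thesis
  proof (rule that[of ?g y0])
    show "proper E ?g" using y0b by (intro proper_swap_cols[OF f]) (auto simp: colour_cols_def)
    show "?g e = f e" if e: "e \<in> L" for e
    proof (cases "f e = a \<or> f e = b")
      case True
      then have "snd e \<in> W" using e unfolding W_def by blast
      then have "snd e \<notin> ?X" using y0(2) by blast
      then show ?thesis by (simp add: swap_cols_def)
    qed (simp add: swap_cols_def)
    show "?g e = f e \<or> ?g e = a \<or> ?g e = b" for e by (simp add: swap_cols_def)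
    show "y0 \<in> colour_cols E f a" by (rule subsetD[OF Xa kempe_cols_start])
    show "y0 \<notin> colour_cols E f b" by (rule y0b)
  qed (rule colour_cols_swap[OF f ab y0b Xa]; assumption)+
qed

section \<open>Evening out the class sizes\<close>

lemma sum_card_fibres:
  assumes "finite S" "finite K" "f ` S \<subseteq> K"
  shows "(\<Sum>c\<in>K. card {e \<in> S. f e = c}) = card S"
proof -
  have "S = (\<Union>c\<in>K. {e \<in> S. f e = c})" using assms(3) by blast
  then have "card S = card (\<Union>c\<in>K. {e \<in> S. f e = c})" by simp
  also have "\<dots> = (\<Sum>c\<in>K. card {e \<in> S. f e = c})"
    using assms by (intro card_UN_disjoint) auto
  finally show ?thesis by simp
qed

lemma card_colour_cols:
  assumes "proper E f"
  shows "card (colour_cols E f c) = card {e \<in> E. f e = c}"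
proof -
  have "inj_on snd {e \<in> E. f e = c}"
    using proper_col[OF assms] by (auto intro!: inj_onI)
  moreover have "snd ` {e \<in> E. f e = c} = colour_cols E f c"
    by (auto simp: colour_cols_def image_def)
  ultimately show ?thesis using card_image[of snd "{e \<in> E. f e = c}"] by simp
qed

text \<open>Induction on the total deficit. A donor \<open>a\<close> is only used if its class stays
  at size at least \<open>n - t\<close>, so each swap lowers the deficit by one. The disjunction
  \<open>large\<close> survives: the donor satisfies its first part, the receiver \<open>b\<close>
  its second, since the cells of \<open>L\<close> keep their colours. The second part is precisely
  what the count over all colours needs, because (n + t)(n - t) = n^2 - t^2.\<close>

lemma balance_colours:
  assumes fin: "finite X" "finite Y" "finite K" and XY: "card X = n" "card Y = n"
    and K: "card K = n + t" and tn: "t \<le> n"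
    and L: "L \<subseteq> X \<times> Y" and f: "proper (X \<times> Y) f" "f ` (X \<times> Y) \<subseteq> K"
    and large: "\<And>c. c \<in> K \<Longrightarrow> n - t \<le> card (colour_cols (X \<times> Y) f c) \<or>
      (n + t) * card {e \<in> L. f e = c} + card L \<le> t\<^sup>2"
  shows "\<exists>g. proper (X \<times> Y) g \<and> g ` (X \<times> Y) \<subseteq> K \<and> (\<forall>e\<in>L. g e = f e) \<and>
    (\<forall>c\<in>K. n - t \<le> card (colour_cols (X \<times> Y) g c))"
  using f large
proof (induction "\<Sum>c\<in>K. n - t - card (colour_cols (X \<times> Y) f c)" arbitrary: f rule: less_induct)
  case less
  let ?E = "X \<times> Y"
  let ?e = "\<lambda>f c. card (colour_cols ?E f c)"
  let ?l = "\<lambda>c. card {e \<in> L. f e = c}"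
  have finL: "finite L" using finite_subset[OF L] fin by simp
  have fL: "f ` L \<subseteq> K" using less.prems(2) L by blast
  show ?case
  proof (cases "\<forall>c\<in>K. n - t \<le> ?e f c")
    case True
    then show ?thesis using less.prems by blast
  next
    case False
    then obtain b where b: "b \<in> K" "?e f b < n - t" by (auto simp: not_le)
    have lb: "(n + t) * ?l b + card L \<le> t\<^sup>2" using less.prems(3)[OF b(1)] b(2) by simp
    have "\<exists>a\<in>K. n - t + ?l a + ?l b < ?e f a"
    proof (rule ccontr)
      assume "\<not> ?thesis"
      then have le: "?e f a \<le> n - t + ?l a + ?l b" if "a \<in> K" for a using that by (meson not_le)
      have "n * n = card ?E" using XY by (simp add: card_cartesian_product)
      also have "\<dots> = (\<Sum>c\<in>K. card {e \<in> ?E. f e = c})"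
        using sum_card_fibres[OF _ fin(3) less.prems(2)] fin by simp
      also have "\<dots> = (\<Sum>c\<in>K. ?e f c)" by (simp add: card_colour_cols[OF less.prems(1)])
      \<comment> \<open>The strict inequality comes from \<open>b\<close> itself, whose class is
        below \<open>n - t\<close>.\<close>
      also have "\<dots> < (\<Sum>c\<in>K. n - t + ?l c + ?l b)"
      proof (rule sum_strict_mono_ex1[OF fin(3)])
        show "\<forall>c\<in>K. ?e f c \<le> n - t + ?l c + ?l b" using le by blast
        have "?e f b < n - t + ?l b + ?l b" using b(2) by linarith
        then show "\<exists>c\<in>K. ?e f c < n - t + ?l c + ?l b" using b(1) by blast
      qed
      also have "\<dots> = (n + t) * (n - t) + (\<Sum>c\<in>K. ?l c) + (n + t) * ?l b"
        by (simp add: sum.distrib K)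
      also have "\<dots> = (n + t) * (n - t) + card L + (n + t) * ?l b"
        by (simp add: sum_card_fibres[OF finL fin(3) fL])
      also have "\<dots> \<le> (n + t) * (n - t) + t\<^sup>2" using lb by linarith
      also have "\<dots> = n * n"
      proof -
        obtain k where "n = t + k" using tn le_Suc_ex by blast
        then show ?thesis by (simp add: power2_eq_square algebra_simps)
      qed
      finally show False by simp
    qed
    then obtain a where a: "a \<in> K" "n - t + ?l a + ?l b < ?e f a" by blast
    have "?e f b + ?l a + ?l b < ?e f a" using a b by simp
    from transfer_colour[OF fin(2) finL order_refl L less.prems(1) this]
    obtain g y0 where g: "proper ?E g" "\<And>e. e \<in> L \<Longrightarrow> g e = f e"
      "\<And>e. g e = f e \<or> g e = a \<or> g e = b"
      "y0 \<in> colour_cols ?E f a" "y0 \<notin> colour_cols ?E f b"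
      "colour_cols ?E g a = colour_cols ?E f a - {y0}"
      "colour_cols ?E g b = insert y0 (colour_cols ?E f b)"
      "\<And>c. c \<noteq> a \<Longrightarrow> c \<noteq> b \<Longrightarrow> colour_cols ?E g c = colour_cols ?E f c" by blast
    have finc: "finite (colour_cols ?E f c)" for c
      by (rule finite_subset[OF _ fin(2)]) (auto simp: colour_cols_def)
    have ab: "a \<noteq> b" using a b by auto
    have ga: "?e g a = ?e f a - 1" using g(4,6) finc by simp
    have gb: "?e g b = Suc (?e f b)" using g(5,7) finc by simp
    have gc: "?e g c = ?e f c" if "c \<noteq> a" "c \<noteq> b" for c using g(8)[OF that] by simp
    have ga': "n - t \<le> ?e g a" using ga a by simp
    have lg: "{e \<in> L. g e = c} = {e \<in> L. f e = c}" for c using g(2) by auto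
    have "(\<Sum>c\<in>K. n - t - ?e g c) < (\<Sum>c\<in>K. n - t - ?e f c)"
    proof (rule sum_strict_mono_ex1[OF fin(3)])
      show "\<forall>c\<in>K. n - t - ?e g c \<le> n - t - ?e f c"
      proof
        fix c
        show "n - t - ?e g c \<le> n - t - ?e f c"
          using ga' gb gc[of c] by (cases "c = a"; cases "c = b"; simp)
      qed
      show "\<exists>c\<in>K. n - t - ?e g c < n - t - ?e f c" using b gb by (intro bexI[of _ b]) auto
    qed
    moreover have "g ` ?E \<subseteq> K"
    proof (rule image_subsetI)
      fix e assume "e \<in> ?E"
      then show "g e \<in> K" using g(3)[of e] a(1) b(1) less.prems(2) by auto
    qed
    moreover have "n - t \<le> ?e g c \<or> (n + t) * card {e \<in> L. g e = c} + card L \<le> t\<^sup>2" if "c \<in> K" for c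
    proof (cases "c = a \<or> c = b")
      case True
      then show ?thesis using ga' lb lg by auto
    next
      case False
      then show ?thesis using less.prems(3)[OF that] gc lg by simp
    qed
    ultimately have "\<exists>h. proper ?E h \<and> h ` ?E \<subseteq> K \<and> (\<forall>e\<in>L. h e = g e) \<and>
        (\<forall>c\<in>K. n - t \<le> ?e h c)"
      using less.hyps[OF _ g(1)] by blast
    then show ?thesis using g(2) by metis
  qed
qed

section \<open>Ryser's theorem\<close>

lemma extend_by_columns:
  assumes fin: "finite A" "finite B" "finite K" "finite T" and K: "card K = card B + card T"
    and disj: "B \<inter> T = {}" and f: "proper (A \<times> B) f" "f ` (A \<times> B) \<subseteq> K"
    and few: "\<And>c. c \<in> K \<Longrightarrow> card {x \<in> A. \<forall>y\<in>B. f (x, y) \<noteq> c} \<le> card T"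
  obtains g where "proper (A \<times> (B \<union> T)) g" "g ` (A \<times> (B \<union> T)) \<subseteq> K" "\<And>e. e \<in> A \<times> B \<Longrightarrow> g e = f e"
proof -
  \<comment> \<open>Rows against the symbols they lack. Every row has degree exactly
    \<open>card T\<close>, so in an edge colouring with \<open>card T\<close> colours each colour
    occurs once in every row: a colour class is a matching of all rows and can serve as one new
    column.\<close>
  define H where "H = {(x, c). x \<in> A \<and> c \<in> K \<and> (\<forall>y\<in>B. f (x, y) \<noteq> c)}"
  have finH: "finite H" by (rule finite_subset[of _ "A \<times> K"]) (use fin in \<open>auto simp: H_def\<close>)
  have row: "card {c. (x, c) \<in> H} = card T" if "x \<in> A" for x
  proof -
    have "{c. (x, c) \<in> H} = K - (\<lambda>y. f (x, y)) ` B" using that unfolding H_def by auto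
    moreover have "(\<lambda>y. f (x, y)) ` B \<subseteq> K" using f(2) that by auto
    moreover have "inj_on (\<lambda>y. f (x, y)) B"
      using that by (intro inj_onI) (rule proper_row[OF f(1)], auto)
    ultimately show ?thesis using K fin by (simp add: card_Diff_subset card_image)
  qed
  have row': "card {c. (x, c) \<in> H} \<le> card T" for x
  proof (cases "x \<in> A")
    case True then show ?thesis using row by simp
  next
    case False then show ?thesis by (simp add: H_def)
  qed
  have "card {x. (x, c) \<in> H} \<le> card T" for c
  proof (cases "c \<in> K")
    case True
    then have "{x. (x, c) \<in> H} = {x \<in> A. \<forall>y\<in>B. f (x, y) \<noteq> c}" unfolding H_def by auto
    then show ?thesis using few[OF True] by simp
  next
    case False then show ?thesis by (simp add: H_def)
  qed
  from koenig_edge_colouring[OF finH row' this]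
  obtain h where h: "proper H h" "\<And>e. e \<in> H \<Longrightarrow> h e < card T" by blast
  obtain \<theta> where \<theta>: "bij_betw \<theta> T {..<card T}"
    using ex_bij_betw_finite_nat[OF fin(4)] by (auto simp: atLeast0LessThan)
  have ex: "\<exists>c. (x, c) \<in> H \<and> h (x, c) = \<theta> y" if "x \<in> A" "y \<in> T" for x y
  proof -
    have "(\<lambda>c. h (x, c)) ` {c. (x, c) \<in> H} = {..<card T}"
    proof (rule card_subset_eq)
      show "(\<lambda>c. h (x, c)) ` {c. (x, c) \<in> H} \<subseteq> {..<card T}" using h(2) by auto
      have "inj_on (\<lambda>c. h (x, c)) {c. (x, c) \<in> H}"
        by (intro inj_onI) (rule proper_row[OF h(1)], auto)
      then show "card ((\<lambda>c. h (x, c)) ` {c. (x, c) \<in> H}) = card {..<card T}"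
        using row[OF that(1)] by (simp add: card_image)
    qed simp
    moreover have "\<theta> y \<in> {..<card T}" using \<theta> that(2) bij_betwE by blast
    ultimately show ?thesis by (metis (mono_tags, lifting) imageE mem_Collect_eq)
  qed
  define g where "g = (\<lambda>(x, y). if y \<in> B then f (x, y) else SOME c. (x, c) \<in> H \<and> h (x, c) = \<theta> y)"
  have gB: "g (x, y) = f (x, y)" if "y \<in> B" for x y using that by (simp add: g_def)
  have gT: "(x, g (x, y)) \<in> H" "h (x, g (x, y)) = \<theta> y" if "x \<in> A" "y \<in> T" for x y
  proof -
    have "y \<notin> B" using that(2) disj by blast
    then have "g (x, y) = (SOME c. (x, c) \<in> H \<and> h (x, c) = \<theta> y)" by (simp add: g_def)
    then show "(x, g (x, y)) \<in> H" "h (x, g (x, y)) = \<theta> y"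
      using someI_ex[OF ex[OF that]] by simp_all
  qed
  have mixed: "g (x, y) \<noteq> g (x, y')" if "x \<in> A" "y \<in> B" "y' \<in> T" for x y y'
    using gT(1)[OF that(1,3)] gB[OF that(2), of x] that(2) unfolding H_def by auto
  have "proper (A \<times> (B \<union> T)) g"
  proof (rule properI)
    fix x y y'
    assume "(x, y) \<in> A \<times> (B \<union> T)" "(x, y') \<in> A \<times> (B \<union> T)"
    then have x: "x \<in> A" and y: "y \<in> B \<union> T" "y' \<in> B \<union> T" by auto
    assume eq: "g (x, y) = g (x, y')"
    consider "y \<in> B" "y' \<in> B" | "y \<in> T" "y' \<in> T"
      using y mixed[OF x, of y y'] mixed[OF x, of y' y] eq by auto
    then show "y = y'"
    proof cases
      case 1
      then show ?thesis using eq x gB by (intro proper_row[OF f(1), of x]) auto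
    next
      case 2
      then have "\<theta> y = \<theta> y'" using gT(2)[OF x] eq by metis
      then show ?thesis using \<theta> 2 by (meson bij_betw_imp_inj_on inj_onD)
    qed
  next
    fix x x' y
    assume "(x, y) \<in> A \<times> (B \<union> T)" "(x', y) \<in> A \<times> (B \<union> T)"
    then have x: "x \<in> A" "x' \<in> A" and y: "y \<in> B \<union> T" by auto
    assume eq: "g (x, y) = g (x', y)"
    show "x = x'"
    proof (cases "y \<in> B")
      case True
      then show ?thesis using eq x gB by (intro proper_col[OF f(1), of x y x']) auto
    next
      case False
      then have "y \<in> T" using y by simp
      then show ?thesis using gT x eq by (intro proper_col[OF h(1), of x "g (x, y)" x']) metis+
    qed
  qed
  moreover have "g ` (A \<times> (B \<union> T)) \<subseteq> K"
  proof (rule image_subsetI)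
    fix e assume "e \<in> A \<times> (B \<union> T)"
    then obtain x y where e: "e = (x, y)" "x \<in> A" "y \<in> B \<or> y \<in> T" by auto
    then show "g e \<in> K" using gT(1)[of x y] gB f(2) unfolding H_def by auto
  qed
  ultimately show thesis using that gB by auto
qed

lemma proper_swap: "proper (A \<times> B) f \<Longrightarrow> proper (B \<times> A) (\<lambda>(y, x). f (x, y))"
  unfolding proper_def by auto

lemma proper_latin_square:
  assumes M: "proper ({1..N} \<times> {1..N}) M" "M ` ({1..N} \<times> {1..N}) \<subseteq> {1..N}"
  shows "latin_square N (\<lambda>i j. M (i, j))"
proof -
  have ex: "\<exists>!j. j \<in> {1..N} \<and> h j = k"
    if h: "inj_on h {1..N}" "h ` {1..N} \<subseteq> {1..N}" "k \<in> {1..N}" for h :: "nat \<Rightarrow> nat" and k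
  proof -
    have "h ` {1..N} = {1..N}" using endo_inj_surj[OF _ h(2,1)] by simp
    then have "k \<in> h ` {1..N}" using h(3) by simp
    then obtain j where j: "k = h j" "j \<in> {1..N}" by (rule imageE)
    show ?thesis
    proof (rule ex1I[of _ j])
      fix j' assume "j' \<in> {1..N} \<and> h j' = k"
      then show "j' = j" using inj_onD[OF h(1), of j' j] j by simp
    qed (use j in simp)
  qed
  show ?thesis
    unfolding latin_square_def
  proof (intro conjI ballI)
    fix i j assume "i \<in> {1..N}" "j \<in> {1..N}"
    then show "M (i, j) \<in> {1..N}" using M(2) by blast
  next
    fix i k assume "i \<in> {1..N}" "k \<in> {1..N}"
    then show "\<exists>!j. j \<in> {1..N} \<and> M (i, j) = k"
      using M(2) by (intro ex inj_onI) (rule proper_row[OF M(1), of i], auto)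
  next
    fix j k assume "j \<in> {1..N}" "k \<in> {1..N}"
    then show "\<exists>!i. i \<in> {1..N} \<and> M (i, j) = k"
      using M(2) by (intro ex inj_onI) (rule proper_col[OF M(1), of _ j], auto)
  qed
qed

text \<open>In the square a symbol fills as many rows as columns, so \<open>many\<close> bounds the
  rows that lack it and columns can be added. In the resulting rectangle every row contains every
  symbol; a symbol then occupies exactly \<open>n\<close> columns and is missing from
  \<open>t\<close>, so the transposed extension applies without a further condition.\<close>

theorem ryser_embedding:
  fixes f :: "nat \<times> nat \<Rightarrow> nat"
  assumes f: "proper ({1..n} \<times> {1..n}) f" "f ` ({1..n} \<times> {1..n}) \<subseteq> {1..n + t}"
    and many: "\<And>c. c \<in> {1..n + t} \<Longrightarrow> n - t \<le> card (colour_cols ({1..n} \<times> {1..n}) f c)"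
  obtains M where "latin_square (n + t) M" "\<And>i j. i \<in> {1..n} \<Longrightarrow> j \<in> {1..n} \<Longrightarrow> M i j = f (i, j)"
proof -
  let ?A = "{1..n}" and ?T = "{n + 1..n + t}" and ?N = "{1..n + t}"
  have N: "?A \<union> ?T = ?N" by auto
  have dis: "?A \<inter> ?T = {}" by auto
  have few: "card {x \<in> ?A. \<forall>y\<in>?A. f (x, y) \<noteq> c} \<le> card ?T" if "c \<in> ?N" for c
  proof -
    let ?R = "{e \<in> ?A \<times> ?A. f e = c}"
    have "inj_on fst ?R" using proper_row[OF f(1)] by (auto intro!: inj_onI)
    then have "card (fst ` ?R) = card (colour_cols (?A \<times> ?A) f c)"
      by (simp only: card_image card_colour_cols[OF f(1)])
    moreover have "{x \<in> ?A. \<forall>y\<in>?A. f (x, y) \<noteq> c} = ?A - fst ` ?R" by force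
    moreover have "card (?A - fst ` ?R) = card ?A - card (fst ` ?R)"
      by (rule card_Diff_subset) auto
    ultimately show ?thesis using many[OF that] by simp
  qed
  obtain g where g: "proper (?A \<times> ?N) g" "g ` (?A \<times> ?N) \<subseteq> ?N" "\<And>e. e \<in> ?A \<times> ?A \<Longrightarrow> g e = f e"
    using extend_by_columns[of ?A ?A ?N ?T f] f few dis unfolding N by auto
  let ?g = "\<lambda>(y, x). g (x, y)"
  have g': "proper (?N \<times> ?A) ?g" "?g ` (?N \<times> ?A) \<subseteq> ?N"
    using proper_swap[OF g(1)] g(2) by auto
  have few': "card {y \<in> ?N. \<forall>x\<in>?A. ?g (y, x) \<noteq> c} \<le> card ?T" if c: "c \<in> ?N" for c
  proof -
    have "\<exists>y. y \<in> ?N \<and> g (x, y) = c" if x: "x \<in> ?A" for x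
    proof -
      have "(\<lambda>y. g (x, y)) ` ?N = ?N"
      proof (rule endo_inj_surj)
        show "(\<lambda>y. g (x, y)) ` ?N \<subseteq> ?N" using g(2) x by blast
        show "inj_on (\<lambda>y. g (x, y)) ?N"
          using x by (intro inj_onI) (rule proper_row[OF g(1), of x], auto)
      qed simp
      then show ?thesis using c by (metis imageE)
    qed
    then obtain p where p: "\<And>x. x \<in> ?A \<Longrightarrow> p x \<in> ?N \<and> g (x, p x) = c" by metis
    have "inj_on p ?A"
    proof (rule inj_onI)
      fix x x' assume "x \<in> ?A" "x' \<in> ?A" "p x = p x'"
      then show "x = x'" using p by (intro proper_col[OF g(1), of x "p x" x']) (metis SigmaI)+
    qed
    then have "card (p ` ?A) = n" by (simp add: card_image)
    moreover have "p ` ?A \<subseteq> ?N" using p by blast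
    then have "card (?N - p ` ?A) = card ?N - card (p ` ?A)" by (intro card_Diff_subset) auto
    moreover have "card {y \<in> ?N. \<forall>x\<in>?A. ?g (y, x) \<noteq> c} \<le> card (?N - p ` ?A)"
      using p by (intro card_mono) auto
    ultimately show ?thesis by simp
  qed
  obtain h where h: "proper (?N \<times> ?N) h" "h ` (?N \<times> ?N) \<subseteq> ?N" "\<And>e. e \<in> ?N \<times> ?A \<Longrightarrow> h e = ?g e"
    using extend_by_columns[of ?N ?A ?N ?T ?g] g' few' dis unfolding N by auto
  have "proper (?N \<times> ?N) (\<lambda>(x, y). h (y, x))" "(\<lambda>(x, y). h (y, x)) ` (?N \<times> ?N) \<subseteq> ?N"
    using proper_swap[OF h(1)] h(2) by auto
  from proper_latin_square[OF this] have "latin_square (n + t) (\<lambda>i j. h (j, i))" by simp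
  then show thesis by (rule that) (use h(3) g(3) in auto)
qed

section \<open>Completing lines\<close>

text \<open>The elements of \<open>R\<close> are inserted one by one, with at most one exchange. If
  all free partners are bad for the new \<open>r\<close>, at most \<open>k\<close> are free, so more
  than 2k elements are matched. For a fixed free \<open>c\<close>, at most \<open>k\<close> of these
  have a partner bad for \<open>r\<close> and at most \<open>k\<close> are bad with
  \<open>c\<close>; any other one takes \<open>c\<close> and leaves its partner to
  \<open>r\<close>.\<close>

lemma saturating_matching:
  assumes fin: "finite R" "finite C" and RC: "card R \<le> card C" and k: "3 * k < card C"
    and R: "\<And>r. r \<in> R \<Longrightarrow> card {c \<in> C. bad r c} \<le> k"
    and C: "\<And>c. c \<in> C \<Longrightarrow> card {r \<in> R. bad r c} \<le> k"
  shows "\<exists>\<sigma>. inj_on \<sigma> R \<and> \<sigma> ` R \<subseteq> C \<and> (\<forall>r\<in>R. \<not> bad r (\<sigma> r))"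
proof -
  have "S \<subseteq> R \<Longrightarrow> \<exists>\<sigma>. inj_on \<sigma> S \<and> \<sigma> ` S \<subseteq> C \<and> (\<forall>r\<in>S. \<not> bad r (\<sigma> r))" if "finite S" for S
    using that
  proof (induction S rule: finite_induct)
    case empty
    show ?case by simp
  next
    case (insert r S)
    then obtain \<sigma> where \<sigma>: "inj_on \<sigma> S" "\<sigma> ` S \<subseteq> C" "\<And>r. r \<in> S \<Longrightarrow> \<not> bad r (\<sigma> r)" by auto
    have rR: "r \<in> R" "S \<subseteq> R" using insert.prems by auto
    have cS: "card (\<sigma> ` S) = card S" using \<sigma>(1) by (rule card_image)
    have "card S < card R" using insert rR by (intro psubset_card_mono[OF fin(1)]) auto
    then have "\<not> C \<subseteq> \<sigma> ` S"
      using card_mono[of "\<sigma> ` S" C] RC cS insert.hyps(1) by auto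
    then obtain c where c: "c \<in> C" "c \<notin> \<sigma> ` S" by blast
    show ?case
    proof (cases "\<exists>c. c \<in> C \<and> c \<notin> \<sigma> ` S \<and> \<not> bad r c")
      case True
      then obtain d where d: "d \<in> C" "d \<notin> \<sigma> ` S" "\<not> bad r d" by blast
      have eq: "(\<sigma>(r := d)) x = \<sigma> x" if "x \<in> S" for x using insert.hyps(2) that by auto
      have "inj_on (\<sigma>(r := d)) S" using \<sigma>(1) by (subst inj_on_cong[OF eq])
      moreover have "(\<sigma>(r := d)) ` S = \<sigma> ` S" by (rule image_cong[OF refl eq])
      ultimately have "inj_on (\<sigma>(r := d)) (insert r S)"
        using d(2) by (auto simp del: fun_upd_image)
      moreover have "(\<sigma>(r := d)) ` insert r S \<subseteq> C" using \<sigma>(2) d(1) by auto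
      moreover have "\<forall>u\<in>insert r S. \<not> bad u ((\<sigma>(r := d)) u)" using \<sigma>(3) d(3) by auto
      ultimately show ?thesis by blast
    next
      case False
      then have "C \<subseteq> \<sigma> ` S \<union> {c \<in> C. bad r c}" by blast
      then have "card C \<le> card (\<sigma> ` S \<union> {c \<in> C. bad r c})"
        using insert.hyps(1) fin(2) by (intro card_mono) auto
      also have "\<dots> \<le> card S + k"
        using card_Un_le[of "\<sigma> ` S" "{c \<in> C. bad r c}"] cS R[OF rR(1)] by linarith
      finally have "2 * k < card S" using k by linarith
      have "{x \<in> S. bad r (\<sigma> x)} = {x \<in> S. \<sigma> x \<in> {c \<in> C. bad r c}}" using \<sigma>(2) by auto
      then have "card {x \<in> S. bad r (\<sigma> x)} \<le> card {c \<in> C. bad r c}"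
        using \<sigma>(1) fin(2) by (intro card_inj_on_le[of \<sigma>]) (auto simp: inj_on_def)
      then have "card {x \<in> S. bad r (\<sigma> x)} \<le> k" using R[OF rR(1)] by linarith
      moreover have "card {x \<in> S. bad x c} \<le> k"
        using card_mono[of "{r \<in> R. bad r c}" "{x \<in> S. bad x c}"] rR(2) fin(1) C[OF c(1)] by fastforce
      ultimately have "card ({x \<in> S. bad r (\<sigma> x)} \<union> {x \<in> S. bad x c}) < card S"
        using card_Un_le[of "{x \<in> S. bad r (\<sigma> x)}" "{x \<in> S. bad x c}"] \<open>2 * k < card S\<close> by linarith
      then have "{x \<in> S. bad r (\<sigma> x)} \<union> {x \<in> S. bad x c} \<noteq> S" by force
      then obtain x where x: "x \<in> S" "\<not> bad r (\<sigma> x)" "\<not> bad x c" by blast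
      have rx: "r \<noteq> x" "r \<notin> S" using insert.hyps(2) x(1) by auto
      let ?\<tau> = "\<sigma>(x := c, r := \<sigma> x)"
      have "inj_on ?\<tau> (insert r S)"
        using \<sigma>(1) c(2) rx x(1) unfolding inj_on_def by (auto split: if_splits)
      moreover have "?\<tau> ` insert r S \<subseteq> C" using \<sigma>(2) c(1) x(1) by auto
      moreover have "\<forall>u\<in>insert r S. \<not> bad u (?\<tau> u)" using \<sigma>(3) x rx by auto
      ultimately show ?thesis by blast
    qed
  qed
  then show ?thesis using fin(1) by blast
qed

text \<open>
  A partial Latin square is the set of its triples (row, column, symbol), so that the three kinds
  of lines are permuted by rotating the coordinates.
\<close>

definition rot :: "('a \<times> 'a \<times> 'a) set \<Rightarrow> ('a \<times> 'a \<times> 'a) set" where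
  "rot P = {(y, z, x). (x, y, z) \<in> P}"

text \<open>A line as the set of the other two coordinates of its triples. \<open>layer P x\<close>
  is a row, \<open>layer (rot P) y\<close> a column and \<open>layer (rot (rot P)) z\<close> a
  symbol.\<close>

definition layer :: "('a \<times> 'a \<times> 'a) set \<Rightarrow> 'a \<Rightarrow> ('a \<times> 'a) set" where
  "layer P x = {(y, z). (x, y, z) \<in> P}"

definition latin_triples :: "('a \<times> 'a \<times> 'a) set \<Rightarrow> bool" where
  "latin_triples P \<longleftrightarrow>
     (\<forall>x y z z'. (x, y, z) \<in> P \<longrightarrow> (x, y, z') \<in> P \<longrightarrow> z = z') \<and>
     (\<forall>y z x x'. (x, y, z) \<in> P \<longrightarrow> (x', y, z) \<in> P \<longrightarrow> x = x') \<and>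
     (\<forall>z x y y'. (x, y, z) \<in> P \<longrightarrow> (x, y', z) \<in> P \<longrightarrow> y = y')"

definition full_layer :: "'a set \<Rightarrow> ('a \<times> 'a \<times> 'a) set \<Rightarrow> 'a \<Rightarrow> bool" where
  "full_layer V P x \<longleftrightarrow> (\<forall>y\<in>V. \<exists>z. (x, y, z) \<in> P) \<and> (\<forall>z\<in>V. \<exists>y. (x, y, z) \<in> P)"

lemma in_rot [simp]: "(y, z, x) \<in> rot P \<longleftrightarrow> (x, y, z) \<in> P"
  by (simp add: rot_def)

lemma in_layer [simp]: "(y, z) \<in> layer P x \<longleftrightarrow> (x, y, z) \<in> P"
  by (simp add: layer_def)

lemma in_image_layer:
  "y \<in> fst ` layer P x \<longleftrightarrow> (\<exists>z. (x, y, z) \<in> P)" "z \<in> snd ` layer P x \<longleftrightarrow> (\<exists>y. (x, y, z) \<in> P)"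
  unfolding image_iff layer_def by auto

lemma rot_rot_rot: "rot (rot (rot P)) = P"
  by (auto simp: rot_def)

lemma rot_mono: "P \<subseteq> Q \<Longrightarrow> rot P \<subseteq> rot Q"
  by (auto simp: rot_def)

lemma finite_rot: "finite P \<Longrightarrow> finite (rot P)"
proof -
  have "rot P = (\<lambda>(x, y, z). (y, z, x)) ` P" by (force simp: rot_def)
  then show "finite P \<Longrightarrow> finite (rot P)" by simp
qed

lemma finite_layer: "finite P \<Longrightarrow> finite (layer P x)"
proof -
  have "layer P x \<subseteq> snd ` P" by force
  then show "finite P \<Longrightarrow> finite (layer P x)" using finite_subset by blast
qed

lemma latin_triples_unique:
  assumes "latin_triples P"
  shows "(x, y, z) \<in> P \<Longrightarrow> (x, y, z') \<in> P \<Longrightarrow> z = z'"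
    and "(x, y, z) \<in> P \<Longrightarrow> (x', y, z) \<in> P \<Longrightarrow> x = x'"
    and "(x, y, z) \<in> P \<Longrightarrow> (x, y', z) \<in> P \<Longrightarrow> y = y'"
  using assms unfolding latin_triples_def by blast+

lemma latin_triples_rot: "latin_triples P \<Longrightarrow> latin_triples (rot P)"
  unfolding latin_triples_def in_rot by blast

lemma inj_on_layer:
  assumes "latin_triples P"
  shows "inj_on fst (layer P x)" "inj_on snd (layer P x)"
  using latin_triples_unique[OF assms] by (auto intro!: inj_onI)

lemma full_layer_mono: "full_layer V P x \<Longrightarrow> P \<subseteq> Q \<Longrightarrow> full_layer V Q x"
  unfolding full_layer_def by blast

text \<open>
  \<open>A\<close>, \<open>B\<close>, \<open>C\<close> are the rows, columns and symbols to be completed in \<open>V\<close> and \<open>A'\<close>, \<open>B'\<close>, \<open>C'\<close>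
  the ones already completed. Two lines of different kinds which are to be completed must already
  meet in a triple: only then are all the cells still missing on such a line on lines with few
  entries.
\<close>

definition partially_completed ::
  "'a set \<Rightarrow> 'a set \<Rightarrow> 'a set \<Rightarrow> 'a set \<Rightarrow> 'a set \<Rightarrow> 'a set \<Rightarrow> 'a set \<Rightarrow>
   ('a \<times> 'a \<times> 'a) set \<Rightarrow> ('a \<times> 'a \<times> 'a) set \<Rightarrow> bool" where
  "partially_completed V A B C A' B' C' L P \<longleftrightarrow>
     latin_triples P \<and> L \<subseteq> P \<and> P \<subseteq> V \<times> V \<times> V \<and> A' \<subseteq> A \<and> B' \<subseteq> B \<and> C' \<subseteq> C \<and>
     (\<forall>x y z. (x, y, z) \<in> P \<longrightarrow> (x, y, z) \<in> L \<or> x \<in> A' \<or> y \<in> B \<or> z \<in> C) \<and>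
     (\<forall>x y z. (x, y, z) \<in> P \<longrightarrow> (x, y, z) \<in> L \<or> y \<in> B' \<or> z \<in> C \<or> x \<in> A) \<and>
     (\<forall>x y z. (x, y, z) \<in> P \<longrightarrow> (x, y, z) \<in> L \<or> z \<in> C' \<or> x \<in> A \<or> y \<in> B) \<and>
     (\<forall>x\<in>A. \<forall>y\<in>B. \<exists>z. (x, y, z) \<in> P) \<and> (\<forall>y\<in>B. \<forall>z\<in>C. \<exists>x. (x, y, z) \<in> P) \<and>
     (\<forall>z\<in>C. \<forall>x\<in>A. \<exists>y. (x, y, z) \<in> P)"

lemma partially_completedD:
  assumes "partially_completed V A B C A' B' C' L P"
  shows "latin_triples P" "L \<subseteq> P" "P \<subseteq> V \<times> V \<times> V" "A' \<subseteq> A" "B' \<subseteq> B" "C' \<subseteq> C"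
    and "(x, y, z) \<in> P \<Longrightarrow> (x, y, z) \<in> L \<or> x \<in> A' \<or> y \<in> B \<or> z \<in> C"
    and "(x, y, z) \<in> P \<Longrightarrow> (x, y, z) \<in> L \<or> y \<in> B' \<or> z \<in> C \<or> x \<in> A"
    and "(x, y, z) \<in> P \<Longrightarrow> (x, y, z) \<in> L \<or> z \<in> C' \<or> x \<in> A \<or> y \<in> B"
    and "x \<in> A \<Longrightarrow> y \<in> B \<Longrightarrow> \<exists>z. (x, y, z) \<in> P"
    and "y \<in> B \<Longrightarrow> z \<in> C \<Longrightarrow> \<exists>x. (x, y, z) \<in> P"
    and "z \<in> C \<Longrightarrow> x \<in> A \<Longrightarrow> \<exists>y. (x, y, z) \<in> P"
  using assms unfolding partially_completed_def by simp_all

lemma partially_completed_rot: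
  assumes "partially_completed V A B C A' B' C' L P"
  shows "partially_completed V B C A B' C' A' (rot L) (rot P)"
proof -
  note D = partially_completedD[OF assms]
  have "rot P \<subseteq> V \<times> V \<times> V" using D(3) by (auto simp: rot_def)
  then show ?thesis
    unfolding partially_completed_def in_rot
    by (intro conjI allI impI ballI latin_triples_rot rot_mono D(1,2,4,5,6))
      (use D(7-12) in blast)+
qed

text \<open>A triple outside \<open>L\<close> on an uncompleted row has its column in
  \<open>B\<close> or its symbol in \<open>C\<close>, and each of these meets the row at most
  once.\<close>

lemma card_layer_le:
  assumes pc: "partially_completed V A B C A' B' C' L P"
    and fin: "finite L" "finite B" "finite C" and x: "x \<notin> A'"
  shows "card (layer P x) \<le> card (layer L x) + card B + card C"
proof -
  have P: "latin_triples P" using pc unfolding partially_completed_def by blast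
  have inj: "inj_on fst {p \<in> layer P x. fst p \<in> B}" "inj_on snd {p \<in> layer P x. snd p \<in> C}"
    by (rule inj_on_subset[OF inj_on_layer(1)[OF P]], blast)
      (rule inj_on_subset[OF inj_on_layer(2)[OF P]], blast)
  have sub: "fst ` {p \<in> layer P x. fst p \<in> B} \<subseteq> B" "snd ` {p \<in> layer P x. snd p \<in> C} \<subseteq> C"
    by auto
  have "layer P x \<subseteq> layer L x \<union> {p \<in> layer P x. fst p \<in> B} \<union> {p \<in> layer P x. snd p \<in> C}"
    (is "_ \<subseteq> ?U")
  proof (rule subrelI)
    fix y z assume "(y, z) \<in> layer P x"
    then show "(y, z) \<in> ?U" using partially_completedD(7)[OF pc, of x y z] x by auto
  qed
  moreover have "finite ?U"
    using finite_layer[OF fin(1)] inj_on_finite[OF inj(1) sub(1) fin(2)]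
      inj_on_finite[OF inj(2) sub(2) fin(3)] by simp
  ultimately have "card (layer P x) \<le> card ?U" by (rule card_mono[rotated])
  also have "\<dots> \<le> card (layer L x) + card {p \<in> layer P x. fst p \<in> B} + card {p \<in> layer P x. snd p \<in> C}"
    by (intro order_trans[OF card_Un_le] add_mono card_Un_le order_refl)
  also have "\<dots> \<le> card (layer L x) + card B + card C"
    by (intro add_mono order_refl card_inj_on_le[OF inj(1) sub(1) fin(2)]
        card_inj_on_le[OF inj(2) sub(2) fin(3)])
  finally show ?thesis .
qed

text \<open>The empty columns \<open>Y\<close> and absent symbols \<open>Z\<close> of row
  \<open>x0\<close> must be matched so that no column repeats a symbol. As \<open>x0\<close> already
  meets all of \<open>B\<close> and \<open>C\<close>, every line of \<open>Y\<close> and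
  \<open>Z\<close> is light and \<open>card_layer_le\<close> bounds its forbidden partners by
  \<open>k\<close>. The summand 3 * (...) in \<open>room\<close> is the 3k of
  \<open>saturating_matching\<close>; the rest bounds the entries already in the row.\<close>

lemma complete_line:
  assumes pc: "partially_completed V A B C A' B' C' L P"
    and V: "finite V" "A \<subseteq> V" "B \<subseteq> V" "C \<subseteq> V" and x0: "x0 \<in> A" "x0 \<notin> A'"
    and sB: "\<And>y. y \<in> V - B \<Longrightarrow> card (layer (rot L) y) \<le> s"
    and sC: "\<And>z. z \<in> V - C \<Longrightarrow> card (layer (rot (rot L)) z) \<le> s"
    and room: "card (layer L x0) + card B + card C + 3 * (card A + card B + card C + s) < card V"
  shows "\<exists>P'. partially_completed V A B C (insert x0 A') B' C' L P' \<and> P \<subseteq> P' \<and> full_layer V P' x0"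
proof -
  note D = partially_completedD[OF pc]
  have P: "latin_triples P" and PV: "P \<subseteq> V \<times> V \<times> V" and LP: "L \<subseteq> P" by (fact D)+
  have fin: "finite P" "finite L" "finite A" "finite B" "finite C"
    using finite_subset[OF PV] finite_subset[OF LP] V finite_subset by (auto intro: finite_subset)
  define Y where "Y = {y \<in> V. \<forall>z. (x0, y, z) \<notin> P}"
  define Z where "Z = {z \<in> V. \<forall>y. (x0, y, z) \<notin> P}"
  define k where "k = card A + card B + card C + s"
  have YB: "Y \<subseteq> V - B" and ZC: "Z \<subseteq> V - C" using D(10,12) x0(1) unfolding Y_def Z_def by blast+
  have finYZ: "finite Y" "finite Z" using V unfolding Y_def Z_def by simp_all
  have YZ_eq: "Y = V - fst ` layer P x0" "Z = V - snd ` layer P x0"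
    by (auto simp: Y_def Z_def in_image_layer)
  have im: "fst ` layer P x0 \<subseteq> V" "snd ` layer P x0 \<subseteq> V" using PV by auto
  have cY: "card Y = card V - card (layer P x0)"
    unfolding YZ_eq using card_Diff_subset[OF finite_subset[OF im(1) V(1)] im(1)]
    by (simp add: card_image inj_on_layer[OF P])
  have cZ: "card Z = card V - card (layer P x0)"
    unfolding YZ_eq using card_Diff_subset[OF finite_subset[OF im(2) V(1)] im(2)]
    by (simp add: card_image inj_on_layer[OF P])
  have "card (layer P x0) \<le> card (layer L x0) + card B + card C"
    by (rule card_layer_le[OF pc fin(2,4,5) x0(2)])
  then have k: "3 * k < card Z" using cZ room unfolding k_def by linarith
  have Yk: "card {z \<in> Z. \<exists>x. (x, y, z) \<in> P} \<le> k" if "y \<in> Y" for y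
  proof -
    have y: "y \<in> V - B" using that YB by blast
    then have "y \<notin> B'" using D(5,6) by blast
    have "card {z \<in> Z. \<exists>x. (x, y, z) \<in> P} \<le> card (fst ` layer (rot P) y)"
      using fin by (intro card_mono finite_imageI finite_layer finite_rot) (auto simp: in_image_layer)
    also have "\<dots> \<le> card (layer (rot P) y)"
      using fin by (intro card_image_le finite_layer finite_rot)
    also have "\<dots> \<le> card (layer (rot L) y) + card C + card A"
      by (rule card_layer_le[OF partially_completed_rot[OF pc] finite_rot[OF fin(2)] fin(5,3) \<open>y \<notin> B'\<close>])
    finally show ?thesis using sB[OF y] unfolding k_def by linarith
  qed
  have Zk: "card {y \<in> Y. \<exists>x. (x, y, z) \<in> P} \<le> k" if "z \<in> Z" for z
  proof -
    have z: "z \<in> V - C" using that ZC by blast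
    then have "z \<notin> C'" using D(5,6) by blast
    have "card {y \<in> Y. \<exists>x. (x, y, z) \<in> P} \<le> card (snd ` layer (rot (rot P)) z)"
      using fin by (intro card_mono finite_imageI finite_layer finite_rot) (auto simp: in_image_layer)
    also have "\<dots> \<le> card (layer (rot (rot P)) z)"
      using fin by (intro card_image_le finite_layer finite_rot)
    also have "\<dots> \<le> card (layer (rot (rot L)) z) + card A + card B"
      by (rule card_layer_le[OF partially_completed_rot[OF partially_completed_rot[OF pc]]
            finite_rot[OF finite_rot[OF fin(2)]] fin(3,4) \<open>z \<notin> C'\<close>])
    finally show ?thesis using sC[OF z] unfolding k_def by linarith
  qed
  have "card Y \<le> card Z" using cY cZ by simp
  from saturating_matching[OF finYZ this k Yk Zk]
  obtain \<sigma> where \<sigma>: "inj_on \<sigma> Y" "\<sigma> ` Y \<subseteq> Z" "\<And>y. y \<in> Y \<Longrightarrow> \<forall>x. (x, y, \<sigma> y) \<notin> P" by auto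
  have "\<sigma> ` Y = Z"
    using \<sigma> cY cZ finYZ by (intro card_subset_eq) (auto simp: card_image)
  define P' where "P' = P \<union> {(x0, y, \<sigma> y) | y. y \<in> Y}"
  have P': "(x, y, z) \<in> P' \<longleftrightarrow> (x, y, z) \<in> P \<or> x = x0 \<and> y \<in> Y \<and> z = \<sigma> y" for x y z
    unfolding P'_def by blast
  have PP': "P \<subseteq> P'" unfolding P'_def by blast
  have \<sigma>Z: "\<And>y y'. y \<in> Y \<Longrightarrow> (x0, y', \<sigma> y) \<notin> P" using \<sigma>(2) unfolding Z_def by blast
  have "latin_triples P'"
    unfolding latin_triples_def
  proof (intro conjI allI impI)
    fix x y z z' assume "(x, y, z) \<in> P'" "(x, y, z') \<in> P'"
    then show "z = z'" using latin_triples_unique(1)[OF P, of x y z z'] unfolding P' Y_def by auto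
  next
    fix y z x x' assume "(x, y, z) \<in> P'" "(x', y, z) \<in> P'"
    then show "x = x'" using latin_triples_unique(2)[OF P, of x y z x'] \<sigma>(3)[of y] unfolding P' by auto
  next
    fix z x y y' assume "(x, y, z) \<in> P'" "(x, y', z) \<in> P'"
    then show "y = y'"
      using latin_triples_unique(3)[OF P, of x y z y'] \<sigma>Z inj_onD[OF \<sigma>(1), of y y'] unfolding P' by auto
  qed
  moreover have "P' \<subseteq> V \<times> V \<times> V"
    using PV \<sigma>(2) V(2) x0(1) unfolding P'_def Y_def Z_def by auto
  moreover have "(x, y, z) \<in> L \<or> x \<in> insert x0 A' \<or> y \<in> B \<or> z \<in> C"
    "(x, y, z) \<in> L \<or> y \<in> B' \<or> z \<in> C \<or> x \<in> A" "(x, y, z) \<in> L \<or> z \<in> C' \<or> x \<in> A \<or> y \<in> B"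
    if "(x, y, z) \<in> P'" for x y z
    using D(7-9)[of x y z] that x0(1) unfolding P' by auto
  moreover have "\<exists>z. (x, y, z) \<in> P'" if "x \<in> A" "y \<in> B" for x y
    using D(10)[OF that] PP' by blast
  moreover have "\<exists>x. (x, y, z) \<in> P'" if "y \<in> B" "z \<in> C" for y z
    using D(11)[OF that] PP' by blast
  moreover have "\<exists>y. (x, y, z) \<in> P'" if "z \<in> C" "x \<in> A" for z x
    using D(12)[OF that] PP' by blast
  moreover have "L \<subseteq> P'" "insert x0 A' \<subseteq> A" using LP PP' D(4) x0(1) by auto
  ultimately have "partially_completed V A B C (insert x0 A') B' C' L P'"
    using D(5,6) unfolding partially_completed_def by simp
  moreover have "full_layer V P' x0"
    unfolding full_layer_def
  proof (intro conjI ballI)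
    fix y assume "y \<in> V"
    then show "\<exists>z. (x0, y, z) \<in> P'" unfolding P' Y_def by blast
  next
    fix z assume z: "z \<in> V"
    show "\<exists>y. (x0, y, z) \<in> P'"
    proof (cases "z \<in> Z")
      case True
      then show ?thesis using \<open>\<sigma> ` Y = Z\<close> unfolding P' by blast
    next
      case False
      then show ?thesis using z unfolding P' Z_def by blast
    qed
  qed
  ultimately show ?thesis using PP' by blast
qed

text \<open>The set \<open>S\<close> may be a proper part of \<open>A\<close>, so that a family can
  be completed in two stages, with \<open>A'\<close> done earlier.\<close>

lemma complete_lines:
  assumes pc: "partially_completed V A B C A' B' C' L P"
    and V: "finite V" "A \<subseteq> V" "B \<subseteq> V" "C \<subseteq> V" and S: "S \<subseteq> A" "S \<inter> A' = {}"
    and sB: "\<And>y. y \<in> V - B \<Longrightarrow> card (layer (rot L) y) \<le> s"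
    and sC: "\<And>z. z \<in> V - C \<Longrightarrow> card (layer (rot (rot L)) z) \<le> s"
    and room: "\<And>x. x \<in> S \<Longrightarrow>
      card (layer L x) + card B + card C + 3 * (card A + card B + card C + s) < card V"
  shows "\<exists>P'. partially_completed V A B C (A' \<union> S) B' C' L P' \<and> P \<subseteq> P' \<and> (\<forall>x\<in>S. full_layer V P' x)"
proof -
  have "finite S" by (rule finite_subset[OF S(1) finite_subset[OF V(2,1)]])
  then show ?thesis using S room
  proof (induction S rule: finite_induct)
    case empty
    then show ?case using pc by auto
  next
    case (insert x S)
    then obtain P1 where P1: "partially_completed V A B C (A' \<union> S) B' C' L P1" "P \<subseteq> P1"
      "\<And>x. x \<in> S \<Longrightarrow> full_layer V P1 x" by auto
    have "x \<in> A" "x \<notin> A' \<union> S" using insert by auto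
    from complete_line[OF P1(1) V this sB sC insert.prems(3)[of x]]
    obtain P2 where P2: "partially_completed V A B C (insert x (A' \<union> S)) B' C' L P2" "P1 \<subseteq> P2"
      "full_layer V P2 x" by auto
    have "\<forall>x\<in>insert x S. full_layer V P2 x" using full_layer_mono[OF P1(3) P2(2)] P2(3) by auto
    moreover have "insert x (A' \<union> S) = A' \<union> insert x S" by simp
    ultimately show ?case using P1(2) P2(1,2) by (metis order_trans)
  qed
qed

section \<open>Common cells of heavy lines and completion of all chosen lines\<close>

lemma block_filling:
  assumes fin: "finite A" "finite B" "finite W" and le: "card A \<le> s" "card B \<le> s" "s \<le> card W"
  obtains f where "proper (A \<times> B) f" "f ` (A \<times> B) \<subseteq> W"
proof -
  have "{y. (x, y) \<in> A \<times> B} \<subseteq> B" "{x. (x, y) \<in> A \<times> B} \<subseteq> A" for x y by auto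
  then have "card {y. (x, y) \<in> A \<times> B} \<le> s" "card {x. (x, y) \<in> A \<times> B} \<le> s" for x y
    by (auto intro: order_trans[OF card_mono[OF fin(2)] le(2)] order_trans[OF card_mono[OF fin(1)] le(1)])
  from koenig_edge_colouring[OF _ this]
  obtain g where g: "proper (A \<times> B) g" "\<And>e. e \<in> A \<times> B \<Longrightarrow> g e < s" using fin by auto
  obtain w :: "nat \<Rightarrow> 'c" where w: "bij_betw w {0..<card W} W" using ex_bij_betw_nat_finite[OF fin(3)] by blast
  have gW: "g e \<in> {0..<card W}" if "e \<in> A \<times> B" for e using g(2)[OF that] le(3) by auto
  show thesis
  proof (rule that[of "w \<circ> g"])
    show "proper (A \<times> B) (w \<circ> g)"
    proof (rule properI)
      fix x y y' assume e: "(x, y) \<in> A \<times> B" "(x, y') \<in> A \<times> B" "(w \<circ> g) (x, y) = (w \<circ> g) (x, y')"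
      then show "y = y'" using inj_onD[OF bij_betw_imp_inj_on[OF w] _ gW gW]
        by (intro proper_row[OF g(1)]) auto
    next
      fix x x' y assume e: "(x, y) \<in> A \<times> B" "(x', y) \<in> A \<times> B" "(w \<circ> g) (x, y) = (w \<circ> g) (x', y)"
      then show "x = x'" using inj_onD[OF bij_betw_imp_inj_on[OF w] _ gW gW]
        by (intro proper_col[OF g(1)]) auto
    qed
    show "(w \<circ> g) ` (A \<times> B) \<subseteq> W"
    proof (rule image_subsetI)
      fix e assume "e \<in> A \<times> B"
      then show "(w \<circ> g) e \<in> W" using gW bij_betwE[OF w] by simp
    qed
  qed
qed

lemma latin_triples_Un:
  assumes P: "latin_triples P" and Q: "latin_triples Q"
    and sep: "\<And>x y z x' y' z'. (x, y, z) \<in> P \<Longrightarrow> (x', y', z') \<in> Q \<Longrightarrow>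
      \<not> (x = x' \<and> y = y') \<and> \<not> (y = y' \<and> z = z') \<and> \<not> (z = z' \<and> x = x')"
  shows "latin_triples (P \<union> Q)"
  unfolding latin_triples_def Un_iff
proof (intro conjI allI impI)
  fix x y z z' assume "(x, y, z) \<in> P \<or> (x, y, z) \<in> Q" "(x, y, z') \<in> P \<or> (x, y, z') \<in> Q"
  then show "z = z'" using latin_triples_unique(1)[OF P] latin_triples_unique(1)[OF Q] sep by metis
next
  fix y z x x' assume "(x, y, z) \<in> P \<or> (x, y, z) \<in> Q" "(x', y, z) \<in> P \<or> (x', y, z) \<in> Q"
  then show "x = x'" using latin_triples_unique(2)[OF P] latin_triples_unique(2)[OF Q] sep by metis
next
  fix z x y y' assume "(x, y, z) \<in> P \<or> (x, y, z) \<in> Q" "(x, y', z) \<in> P \<or> (x, y', z) \<in> Q"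
  then show "y = y'" using latin_triples_unique(3)[OF P] latin_triples_unique(3)[OF Q] sep by metis
qed

definition block :: "'a set \<Rightarrow> 'a set \<Rightarrow> ('a \<times> 'a \<Rightarrow> 'a) \<Rightarrow> ('a \<times> 'a \<times> 'a) set \<Rightarrow> ('a \<times> 'a \<times> 'a) set" where
  "block A B f L = {(x, y, z). x \<in> A \<and> y \<in> B \<and> z = f (x, y) \<and> (\<forall>z. (x, y, z) \<notin> L)}"

lemma in_block [simp]:
  "(x, y, z) \<in> block A B f L \<longleftrightarrow> x \<in> A \<and> y \<in> B \<and> z = f (x, y) \<and> (\<forall>z. (x, y, z) \<notin> L)"
  by (simp add: block_def)

lemma latin_triples_block:
  assumes "proper (A \<times> B) f"
  shows "latin_triples (block A B f L)"
  using proper_row[OF assms] proper_col[OF assms] unfolding latin_triples_def by auto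

text \<open>Each missing meeting of two kinds of lines gets its third coordinate outside
  \<open>U\<close>. The three blocks have different coordinates outside \<open>U\<close>, so triples
  of two blocks differ in at least two coordinates. Hence the same \<open>s\<close> new elements can
  serve as rows, columns and symbols at once.\<close>

lemma partially_completed_start:
  assumes L: "latin_triples L" "L \<subseteq> U \<times> U \<times> U" and V: "U \<subseteq> V" "finite V"
    and sub: "A \<subseteq> U" "B \<subseteq> U" "C \<subseteq> U"
    and s: "card A \<le> s" "card B \<le> s" "card C \<le> s" "s \<le> card (V - U)"
  obtains P where "partially_completed V A B C {} {} {} L P"
proof -
  have fin: "finite A" "finite B" "finite C" "finite (V - U)"
    using finite_subset[OF _ finite_subset[OF V]] sub V(2) by auto
  obtain p where p: "proper (A \<times> B) p" "p ` (A \<times> B) \<subseteq> V - U"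
    using block_filling[OF fin(1,2,4) s(1,2,4)] .
  obtain q where q: "proper (B \<times> C) q" "q ` (B \<times> C) \<subseteq> V - U"
    using block_filling[OF fin(2,3,4) s(2,3,4)] .
  obtain r where r: "proper (C \<times> A) r" "r ` (C \<times> A) \<subseteq> V - U"
    using block_filling[OF fin(3,1,4) s(3,1,4)] .
  define P1 where "P1 = block A B p L"
  define P2 where "P2 = rot (rot (block B C q (rot L)))"
  define P3 where "P3 = rot (block C A r (rot (rot L)))"
  have P1: "x \<in> A \<and> x \<in> U \<and> y \<in> B \<and> y \<in> U \<and> z \<in> V \<and> z \<notin> U \<and> (\<forall>z. (x, y, z) \<notin> L)"
    if "(x, y, z) \<in> P1" for x y z using that p(2) sub unfolding P1_def by auto
  have P2: "x \<in> V \<and> x \<notin> U \<and> y \<in> B \<and> y \<in> U \<and> z \<in> C \<and> z \<in> U \<and> (\<forall>x. (x, y, z) \<notin> L)"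
    if "(x, y, z) \<in> P2" for x y z using that q(2) sub unfolding P2_def by auto
  have P3: "x \<in> A \<and> x \<in> U \<and> y \<in> V \<and> y \<notin> U \<and> z \<in> C \<and> z \<in> U \<and> (\<forall>y. (x, y, z) \<notin> L)"
    if "(x, y, z) \<in> P3" for x y z using that r(2) sub unfolding P3_def by auto
  have LU: "x \<in> U \<and> y \<in> U \<and> z \<in> U" if "(x, y, z) \<in> L" for x y z using L(2) that by auto
  let ?P = "L \<union> P1 \<union> P2 \<union> P3"
  have "latin_triples P1" "latin_triples P2" "latin_triples P3"
    unfolding P1_def P2_def P3_def
    by (rule latin_triples_block[OF p(1)], (rule latin_triples_rot)+, rule latin_triples_block[OF q(1)],
        rule latin_triples_rot, rule latin_triples_block[OF r(1)])
  then have "latin_triples ?P"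
  proof (intro latin_triples_Un L(1))
    fix x y z x' y' z' assume "(x, y, z) \<in> L" "(x', y', z') \<in> P1"
    then show "\<not> (x = x' \<and> y = y') \<and> \<not> (y = y' \<and> z = z') \<and> \<not> (z = z' \<and> x = x')"
      using LU[of x y z] P1[of x' y' z'] by auto
  next
    fix x y z x' y' z' assume "(x, y, z) \<in> L \<union> P1" "(x', y', z') \<in> P2"
    then show "\<not> (x = x' \<and> y = y') \<and> \<not> (y = y' \<and> z = z') \<and> \<not> (z = z' \<and> x = x')"
      using LU[of x y z] P1[of x y z] P2[of x' y' z'] by auto
  next
    fix x y z x' y' z' assume "(x, y, z) \<in> L \<union> P1 \<union> P2" "(x', y', z') \<in> P3"
    then show "\<not> (x = x' \<and> y = y') \<and> \<not> (y = y' \<and> z = z') \<and> \<not> (z = z' \<and> x = x')"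
      using LU[of x y z] P1[of x y z] P2[of x y z] P3[of x' y' z'] by auto
  qed
  moreover have "?P \<subseteq> V \<times> V \<times> V"
  proof
    fix e assume e: "e \<in> ?P"
    obtain x y z where xyz: "e = (x, y, z)" by (cases e)
    show "e \<in> V \<times> V \<times> V"
      using e V(1) LU[of x y z] P1[of x y z] P2[of x y z] P3[of x y z] unfolding xyz by auto
  qed
  moreover have "\<exists>z. (x, y, z) \<in> ?P" if "x \<in> A" "y \<in> B" for x y
    using that unfolding P1_def by (cases "\<exists>z. (x, y, z) \<in> L") auto
  moreover have "\<exists>x. (x, y, z) \<in> ?P" if "y \<in> B" "z \<in> C" for y z
    using that unfolding P2_def by (cases "\<exists>x. (x, y, z) \<in> L") auto
  moreover have "\<exists>y. (x, y, z) \<in> ?P" if "z \<in> C" "x \<in> A" for x z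
    using that unfolding P3_def by (cases "\<exists>y. (x, y, z) \<in> L") auto
  moreover have "(x, y, z) \<in> L \<or> y \<in> B \<or> z \<in> C" "(x, y, z) \<in> L \<or> z \<in> C \<or> x \<in> A"
    "(x, y, z) \<in> L \<or> x \<in> A \<or> y \<in> B" if "(x, y, z) \<in> ?P" for x y z
    using that P1[of x y z] P2[of x y z] P3[of x y z] by auto
  moreover have "L \<subseteq> ?P" by blast
  ultimately have "partially_completed V A B C {} {} {} L ?P"
    unfolding partially_completed_def by simp
  then show thesis by (rule that)
qed

lemma card_layer_le_card:
  assumes "latin_triples L" "L \<subseteq> U \<times> U \<times> U" "finite U"
  shows "card (layer L x) \<le> card U"
  using assms by (intro card_inj_on_le[OF inj_on_layer(1)]) auto

text \<open>\<open>M\<close> joins only after \<open>A\<close>, \<open>B\<close> and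
  \<open>C\<close> are full, since it may have more than \<open>s\<close> elements and the starting
  blocks could not accommodate it.\<close>

lemma complete_few_lines:
  assumes L: "latin_triples L" "L \<subseteq> U \<times> U \<times> U" and V: "U \<subseteq> V" "finite V" "card V = card U + 15 * s"
    and sub: "A \<subseteq> U" "B \<subseteq> U" "C \<subseteq> U" and s: "card A \<le> s" "card B \<le> s" "card C \<le> s"
    and M: "M \<subseteq> V" "M \<inter> C = {}" and room: "M \<noteq> {} \<Longrightarrow> 12 * s + 3 * card (C \<union> M) < card V"
    and sA: "\<And>x. x \<in> V - A \<Longrightarrow> card (layer L x) \<le> s"
    and sB: "\<And>y. y \<in> V - B \<Longrightarrow> card (layer (rot L) y) \<le> s"
    and sC: "\<And>z. z \<in> V - C \<Longrightarrow> card (layer (rot (rot L)) z) \<le> s"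
  obtains P where "partially_completed V A B (C \<union> M) A B (C \<union> M) L P"
    "\<And>x. x \<in> A \<Longrightarrow> full_layer V P x" "\<And>y. y \<in> B \<Longrightarrow> full_layer V (rot P) y"
    "\<And>z. z \<in> C \<union> M \<Longrightarrow> full_layer V (rot (rot P)) z"
proof -
  have finU: "finite U" using finite_subset[OF V(1,2)] .
  have "s \<le> card (V - U)" using card_Diff_subset[OF finU V(1)] V(3) by simp
  from partially_completed_start[OF L V(1,2) sub s this]
  obtain P0 where P0: "partially_completed V A B C {} {} {} L P0" .
  have subV: "A \<subseteq> V" "B \<subseteq> V" "C \<subseteq> V" using sub V(1) by auto
  \<comment> \<open>The strict inequality 14 s < 15 s needs \<open>s\<close> positive, which holds
    as soon as there is a line to complete.\<close>
  have pos: "0 < s" if "x \<in> S" "S \<subseteq> V" "card S \<le> s" for S x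
    using that finite_subset[OF that(2) V(2)] by (cases "s = 0") auto
  have rL: "latin_triples (rot L)" "rot L \<subseteq> U \<times> U \<times> U"
    using latin_triples_rot[OF L(1)] L(2) by (auto simp: rot_def)
  have rrL: "latin_triples (rot (rot L))" "rot (rot L) \<subseteq> U \<times> U \<times> U"
    using latin_triples_rot[OF rL(1)] rL(2) by (auto simp: rot_def)
  have sA': "card (layer (rot (rot (rot L))) x) \<le> s" if "x \<in> V - A" for x
    using sA[OF that] by (simp add: rot_rot_rot)
  have sB': "card (layer (rot (rot (rot (rot L)))) x) \<le> s" if "x \<in> V - B" for x
    using sB[OF that] by (simp add: rot_rot_rot)
  \<comment> \<open>The left side is at most card U + 2 s + 12 s.\<close>
  have arith: "l + b + c + 3 * (a + b + c + s) < card V"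
    if "l \<le> card U" "a \<le> s" "b \<le> s" "c \<le> s" "0 < s" for a b c l :: nat
    using that V(3) by (simp add: algebra_simps)
  have room1: "card (layer L x) + card B + card C + 3 * (card A + card B + card C + s) < card V"
    if "x \<in> A" for x
    by (rule arith[OF card_layer_le_card[OF L finU] s pos[OF that subV(1) s(1)]])
  have room2: "card (layer (rot L) x) + card C + card A + 3 * (card B + card C + card A + s) < card V"
    if "x \<in> B" for x
    by (rule arith[OF card_layer_le_card[OF rL finU] s(2,3,1) pos[OF that subV(2) s(2)]])
  have room3: "card (layer (rot (rot L)) x) + card A + card B + 3 * (card C + card A + card B + s) < card V"
    if "x \<in> C" for x
    by (rule arith[OF card_layer_le_card[OF rrL finU] s(3,1,2) pos[OF that subV(3) s(3)]])
  obtain P1 where P1: "partially_completed V A B C A {} {} L P1" "\<And>x. x \<in> A \<Longrightarrow> full_layer V P1 x"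
    using complete_lines[OF P0 V(2) subV order_refl _ sB sC room1] by auto
  obtain P2 where P2: "partially_completed V B C A B {} A (rot L) P2" "rot P1 \<subseteq> P2"
    "\<And>x. x \<in> B \<Longrightarrow> full_layer V P2 x"
    using complete_lines[OF partially_completed_rot[OF P1(1)] V(2) subV(2,3,1) order_refl _ sC sA' room2]
    by auto
  obtain P3 where P3: "partially_completed V C A B C A B (rot (rot L)) P3" "rot P2 \<subseteq> P3"
    "\<And>x. x \<in> C \<Longrightarrow> full_layer V P3 x"
    using complete_lines[OF partially_completed_rot[OF P2(1)] V(2) subV(3,1,2) order_refl _ sA' sB' room3]
    by auto
  have P1': "(z, x, y) \<in> P3" if "(x, y, z) \<in> P1" for x y z
    using subsetD[OF P2(2), of "(y, z, x)"] subsetD[OF P3(2), of "(z, x, y)"] that by simp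
  have P2': "(z, x, y) \<in> P3" if "(y, z, x) \<in> P2" for x y z
    using subsetD[OF P3(2), of "(z, x, y)"] that by simp
  \<comment> \<open>A full row or column contains every symbol, so the symbols of \<open>M\<close>
    already meet all lines of \<open>A\<close> and \<open>B\<close>, as the invariant for the larger
    family demands.\<close>
  have occ: "\<exists>y. (z, x, y) \<in> P3" if "x \<in> A" "z \<in> V" for x z
    using P1(2)[OF that(1)] that(2) P1' unfolding full_layer_def by blast
  have occ': "\<exists>x. (z, x, y) \<in> P3" if "y \<in> B" "z \<in> V" for y z
    using P2(3)[OF that(1)] that(2) P2' unfolding full_layer_def by blast
  let ?H = "C \<union> M"
  have HV: "?H \<subseteq> V" using subV M by blast
  note D3 = partially_completedD[OF P3(1)]
  have "(z, x, y) \<in> rot (rot L) \<or> z \<in> C \<or> x \<in> A \<or> y \<in> B"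
    "(z, x, y) \<in> rot (rot L) \<or> x \<in> A \<or> y \<in> B \<or> z \<in> ?H"
    "(z, x, y) \<in> rot (rot L) \<or> y \<in> B \<or> z \<in> ?H \<or> x \<in> A" if "(z, x, y) \<in> P3" for x y z
    using D3(7-9)[OF that] by auto
  moreover have "C \<subseteq> ?H" by blast
  moreover have "\<exists>y. (z, x, y) \<in> P3" if "z \<in> ?H" "x \<in> A" for x z
    by (rule occ[OF that(2) subsetD[OF HV that(1)]])
  moreover have "\<exists>x. (z, x, y) \<in> P3" if "y \<in> B" "z \<in> ?H" for y z
    by (rule occ'[OF that(1) subsetD[OF HV that(2)]])
  ultimately have P3': "partially_completed V ?H A B C A B (rot (rot L)) P3"
    unfolding partially_completed_def using D3(1-6,11) by simp
  \<comment> \<open>Symbols of \<open>M\<close> are light: s for their own cells, 2 s for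
    \<open>A\<close> and \<open>B\<close> and 9 s inside the factor 3 give the 12 s.\<close>
  have room4: "card (layer (rot (rot L)) z) + card A + card B + 3 * (card ?H + card A + card B + s) < card V"
    if "z \<in> M" for z
  proof -
    have "z \<in> V - C" using that M by blast
    then have "card (layer (rot (rot L)) z) \<le> s" by (rule sC)
    moreover have "M \<noteq> {}" using that by blast
    then have "12 * s + 3 * card ?H < card V" by (rule room)
    ultimately show ?thesis using s by presburger
  qed
  obtain P4 where P4: "partially_completed V ?H A B ?H A B (rot (rot L)) P4" "P3 \<subseteq> P4"
    "\<And>x. x \<in> M \<Longrightarrow> full_layer V P4 x"
    using complete_lines[OF P3' V(2) HV subV(1,2) Un_upper2 M(2) sA' sB' room4] by auto
  let ?P = "rot P4"
  have "P1 \<subseteq> ?P" 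
  proof
    fix e assume "e \<in> P1"
    then show "e \<in> ?P" using P4(2) P1' by (cases e) auto
  qed
  have "P2 \<subseteq> rot ?P" 
  proof
    fix e assume "e \<in> P2"
    then show "e \<in> rot ?P" using P4(2) P2' by (cases e) auto
  qed
  show thesis
  proof (rule that[of ?P])
    show "partially_completed V A B ?H A B ?H L ?P"
      using partially_completed_rot[OF P4(1)] by (simp add: rot_rot_rot)
    show "full_layer V ?P x" if "x \<in> A" for x
      by (rule full_layer_mono[OF P1(2)[OF that] \<open>P1 \<subseteq> ?P\<close>])
    show "full_layer V (rot ?P) y" if "y \<in> B" for y
      by (rule full_layer_mono[OF P2(3)[OF that] \<open>P2 \<subseteq> rot ?P\<close>])
    show "full_layer V (rot (rot ?P)) z" if "z \<in> ?H" for z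
      using that P4(3) full_layer_mono[OF P3(3) P4(2)] by (auto simp: rot_rot_rot)
  qed
qed

section \<open>The embedding\<close>

lemma sum_card_layer_le:
  assumes L: "finite L" and S: "finite S"
  shows "(\<Sum>x\<in>S. card (layer L x)) \<le> card L"
proof -
  have "(\<Sum>x\<in>S. card (layer L x)) = card (SIGMA x:S. layer L x)"
    using finite_layer[OF L] S by simp
  also have "\<dots> \<le> card L" by (rule card_mono[OF L]) auto
  finally show ?thesis .
qed

lemma card_heavy_le:
  assumes L: "finite L" "card L \<le> s\<^sup>2" and U: "finite U"
  shows "card {x \<in> U. s < card (layer L x)} \<le> s"
proof -
  let ?A = "{x \<in> U. s < card (layer L x)}"
  have "card ?A * Suc s = (\<Sum>x\<in>?A. Suc s)" by simp
  also have "\<dots> \<le> (\<Sum>x\<in>?A. card (layer L x))" by (rule sum_mono) auto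
  also have "\<dots> \<le> card L" using sum_card_layer_le[OF L(1)] U by simp
  also have "\<dots> \<le> s * s" using L(2) by (simp add: power2_eq_square)
  finally have "card ?A * Suc s \<le> s * Suc s" by simp
  then show ?thesis using mult_le_cancel2 by blast
qed

text \<open>These symbols violate the condition of \<open>balance_colours\<close> for t = 10 s. Each
  has N l > 100 s^2 - |L| \<ge> 99 s^2, while the l sum to at most s^2. For s = 0 the division
  fails, but then \<open>L\<close> is empty.\<close>

lemma card_semiheavy_le:
  assumes L: "finite L" "card L \<le> s\<^sup>2" and V: "finite V"
  shows "99 * card {z \<in> V. (10 * s)\<^sup>2 < N * card (layer L z) + card L} \<le> N"
proof (cases "s = 0")
  case True
  then have "L = {}" using L by simp
  then show ?thesis using True by (simp add: layer_def)
next
  case False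
  let ?M = "{z \<in> V. (10 * s)\<^sup>2 < N * card (layer L z) + card L}"
  have "card ?M * (99 * s\<^sup>2) = (\<Sum>z\<in>?M. 99 * s\<^sup>2)" by simp
  also have "\<dots> \<le> (\<Sum>z\<in>?M. N * card (layer L z))"
  proof (rule sum_mono)
    fix z assume "z \<in> ?M"
    then have "100 * s\<^sup>2 < N * card (layer L z) + card L" by (simp add: power_mult_distrib)
    then show "99 * s\<^sup>2 \<le> N * card (layer L z)" using L(2) by linarith
  qed
  also have "\<dots> = N * (\<Sum>z\<in>?M. card (layer L z))" by (simp add: sum_distrib_left)
  also have "\<dots> \<le> N * card L" using sum_card_layer_le[OF L(1)] V by simp
  also have "\<dots> \<le> N * s\<^sup>2" using L(2) by simp
  finally have "99 * card ?M * s\<^sup>2 \<le> N * s\<^sup>2" by (simp add: ac_simps)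
  then show ?thesis using False by simp
qed

text \<open>Applied to the symbols used in a row and in a column, this charges the completed symbols
  \<open>H\<close> to a list once instead of twice.\<close>

lemma card_Un_le_common:
  assumes "finite X" "finite Y" "H \<subseteq> X" "H \<subseteq> Y"
  shows "card (X \<union> Y) + card H \<le> card X + card Y"
  using card_Un_Int[OF assms(1,2)] card_mono[of "X \<inter> Y" H] assms by simp

lemma balanced_filling:
  fixes L :: "(nat \<times> nat \<times> nat) set"
  assumes L: "latin_triples L" "L \<subseteq> {1..n} \<times> {1..n} \<times> {1..n}" and cL: "card L \<le> s\<^sup>2"
    and sn: "25 * s \<le> n"
  defines "n1 \<equiv> n + 15 * s"
  obtains f where "proper ({1..n1} \<times> {1..n1}) f" "f ` ({1..n1} \<times> {1..n1}) \<subseteq> {1..n1 + 10 * s}"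
    "\<And>x y z. (x, y, z) \<in> L \<Longrightarrow> f (x, y) = z"
    "\<And>c. c \<in> {1..n1 + 10 * s} \<Longrightarrow> n1 - 10 * s \<le> card (colour_cols ({1..n1} \<times> {1..n1}) f c)"
proof -
  define U V K N where "U = {1..n}" "V = {1..n1}" "K = {1..n1 + 10 * s}" "N = n1 + 10 * s"
  note defs = this
  have UV: "U \<subseteq> V" "finite U" "finite V" "card V = card U + 15 * s" and VK: "V \<subseteq> K" "finite K"
    and cV: "card V = n1" and cK: "card K = N"
    unfolding defs n1_def by auto
  have LU: "L \<subseteq> U \<times> U \<times> U" using L(2) unfolding defs .
  have finL: "finite L" using finite_subset[OF LU] UV(2) by simp
  have rL: "rot L \<subseteq> U \<times> U \<times> U" "rot (rot L) \<subseteq> U \<times> U \<times> U" using LU by (auto simp: rot_def)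
  have crot: "card (rot Q) = card Q" for Q :: "(nat \<times> nat \<times> nat) set"
    by (rule bij_betw_same_card[of "\<lambda>(x, y, z). (z, x, y)"])
      (rule bij_betw_byWitness[of _ "\<lambda>(x, y, z). (y, z, x)"], auto simp: rot_def)
  note finr = finite_rot[OF finL] finite_rot[OF finite_rot[OF finL]]
  have cr: "card (rot L) \<le> s\<^sup>2" "card (rot (rot L)) \<le> s\<^sup>2" using cL by (simp_all add: crot)
  define heavy where "heavy Q = {x \<in> U. s < card (layer Q x)}" for Q :: "(nat \<times> nat \<times> nat) set"
  have hU: "heavy Q \<subseteq> U" for Q unfolding heavy_def by blast
  have ch: "card (heavy L) \<le> s" "card (heavy (rot L)) \<le> s" "card (heavy (rot (rot L))) \<le> s"
    unfolding heavy_def using card_heavy_le[OF finL cL UV(2)] card_heavy_le[OF finr(1) cr(1) UV(2)]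
      card_heavy_le[OF finr(2) cr(2) UV(2)] by auto
  have light: "card (layer Q x) \<le> s" if "Q \<subseteq> U \<times> U \<times> U" "x \<in> V - heavy Q" for Q x
  proof (cases "x \<in> U")
    case True
    then show ?thesis using that(2) unfolding heavy_def by auto
  next
    case False
    then have "layer Q x = {}" using that(1) unfolding layer_def by auto
    then show ?thesis by simp
  qed
  define A B C where "A = heavy L" "B = heavy (rot L)" "C = heavy (rot (rot L))"
  note ABC = this
  define M where "M = {z \<in> V. (10 * s)\<^sup>2 < N * card (layer (rot (rot L)) z) + card L} - C"
  have cM: "99 * card M \<le> N"
  proof -
    have "card M \<le> card {z \<in> V. (10 * s)\<^sup>2 < N * card (layer (rot (rot L)) z) + card L}"
      unfolding M_def using UV(3) by (intro card_mono) auto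
    then show ?thesis using card_semiheavy_le[OF finr(2) cr(2) UV(3), of N] by (simp add: crot)
  qed
  \<comment> \<open>From 25 s \<le> n follows N \<le> 2 n, hence 99 |M| \<le> 2 n; \<open>C\<close>
    contributes at most 3 s, filling up 15 s.\<close>
  have room: "12 * s + 3 * card (C \<union> M) < card V" if "M \<noteq> {}"
  proof -
    have "finite M" using UV(3) unfolding M_def by simp
    then have "1 \<le> card M" using that by (simp add: Suc_le_eq card_gt_0_iff)
    moreover have "card (C \<union> M) \<le> s + card M" using card_Un_le[of C M] ch(3) unfolding ABC by simp
    moreover have "99 * card M \<le> 2 * n" using cM sn unfolding defs n1_def by linarith
    ultimately have "3 * card M < n" "card (C \<union> M) \<le> s + card M" by linarith+
    then show ?thesis unfolding cV n1_def by (simp add: algebra_simps)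
  qed
  have M: "M \<subseteq> V" "M \<inter> C = {}" unfolding M_def by auto
  define H where "H = C \<union> M"
  have "\<exists>P. partially_completed V A B H A B H L P \<and> (\<forall>x\<in>A. full_layer V P x) \<and>
      (\<forall>y\<in>B. full_layer V (rot P) y) \<and> (\<forall>z\<in>H. full_layer V (rot (rot P)) z)"
    unfolding ABC H_def
    by (rule complete_few_lines[OF L(1) LU UV(1,3,4) hU hU hU ch M[unfolded ABC] room[unfolded ABC]
        light[OF LU] light[OF rL(1)] light[OF rL(2)]])
      (assumption+, rule exI, intro conjI ballI, assumption, simp_all)
  then obtain P where P: "partially_completed V A B H A B H L P"
    and fP: "\<And>x. x \<in> A \<Longrightarrow> full_layer V P x" "\<And>y. y \<in> B \<Longrightarrow> full_layer V (rot P) y"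
    "\<And>z. z \<in> H \<Longrightarrow> full_layer V (rot (rot P)) z"
    by blast
  note D = partially_completedD[OF P]
  have finP: "finite P" using finite_subset[OF D(3)] UV(3) by simp
  have finH: "finite A" "finite B" "finite H" "H \<subseteq> V"
    using hU UV M finite_subset[OF hU UV(2)] finite_subset[OF M(1) UV(3)] unfolding H_def ABC by auto
  define G where "G = {(x, y). x \<in> V \<and> y \<in> V \<and> (\<forall>z. (x, y, z) \<notin> P)}"
  define X where "X x = snd ` layer P x" for x
  define Y where "Y y = fst ` layer (rot P) y" for y
  have inX: "z \<in> X x \<longleftrightarrow> (\<exists>y. (x, y, z) \<in> P)" for x z unfolding X_def by (rule in_image_layer)
  have inY: "z \<in> Y y \<longleftrightarrow> (\<exists>x. (x, y, z) \<in> P)" for y z unfolding Y_def in_image_layer by simp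
  have XY: "finite (X x)" "finite (Y y)" "card (X x) = card (layer P x)" "card (Y y) = card (layer (rot P) y)"
    for x y
    unfolding X_def Y_def using finite_layer[OF finP] finite_layer[OF finite_rot[OF finP]]
      inj_on_layer(2)[OF D(1)] inj_on_layer(1)[OF latin_triples_rot[OF D(1)]]
    by (simp_all add: card_image)
  have HX: "H \<subseteq> X x" "H \<subseteq> Y x" if "x \<in> V" for x
    using fP(3) that unfolding full_layer_def inX[abs_def] subset_iff inX inY by auto
  have degr: "card {y. (x, y) \<in> G} \<le> n1 - card H" for x
  proof (cases "x \<in> V")
    case True
    have "{y. (x, y) \<in> G} = V - fst ` layer P x"
      using True unfolding G_def by (auto simp: in_image_layer)
    moreover have sub: "fst ` layer P x \<subseteq> V" using D(3) by auto
    moreover have "card (fst ` layer P x) = card (X x)"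
      using XY(3) inj_on_layer(1)[OF D(1)] by (simp add: card_image)
    ultimately have "card {y. (x, y) \<in> G} = n1 - card (X x)"
      using card_Diff_subset[OF finite_subset[OF sub UV(3)] sub] cV by simp
    then show ?thesis using card_mono[OF XY(1) HX(1)[OF True]] by simp
  next
    case False
    then show ?thesis by (simp add: G_def)
  qed
  have degc: "card {x. (x, y) \<in> G} \<le> n1 - card H" for y
  proof (cases "y \<in> V")
    case True
    have "{x. (x, y) \<in> G} = V - snd ` layer (rot P) y"
      using True unfolding G_def by (auto simp: in_image_layer)
    moreover have sub: "snd ` layer (rot P) y \<subseteq> V" using D(3) by auto
    moreover have "card (snd ` layer (rot P) y) = card (Y y)"
      using XY(4) inj_on_layer(2)[OF latin_triples_rot[OF D(1)]] by (simp add: card_image)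
    ultimately have "card {x. (x, y) \<in> G} = n1 - card (Y y)"
      using card_Diff_subset[OF finite_subset[OF sub UV(3)] sub] cV by simp
    then show ?thesis using card_mono[OF XY(2) HX(2)[OF True]] by simp
  next
    case False
    then show ?thesis by (simp add: G_def)
  qed
  define S where "S = (\<lambda>(x, y). K - (X x \<union> Y y))"
  \<comment> \<open>A cell empty in \<open>P\<close> lies on no full line, so both its lines are
    light and use at most |H| + 2 s symbols each. Both contain \<open>H\<close>, so at least n1 + 10
    s - |H| - 4 s colours remain, no fewer than the degree bound.\<close>
  have lists: "finite (S e) \<and> n1 - card H \<le> card (S e)" if "e \<in> G" for e
  proof -
    obtain x y where e: "e = (x, y)" by fastforce
    have xy: "x \<in> V" "y \<in> V" "\<And>z. (x, y, z) \<notin> P" using that unfolding e G_def by auto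
    have x: "x \<notin> A" and y: "y \<notin> B" using fP(1,2) xy unfolding full_layer_def in_rot by blast+
    have "card (X x) \<le> card (layer L x) + card B + card H"
      unfolding XY(3) by (rule card_layer_le[OF P finL finH(2,3) x])
    moreover have "card (layer L x) \<le> s" using light[OF LU] x xy(1) unfolding ABC by blast
    moreover have "card (Y y) \<le> card (layer (rot L) y) + card H + card A"
      unfolding XY(4) by (rule card_layer_le[OF partially_completed_rot[OF P] finr(1) finH(3,1) y])
    moreover have "card (layer (rot L) y) \<le> s" using light[OF rL(1)] y xy(2) unfolding ABC by blast
    moreover have "card (X x \<union> Y y) + card H \<le> card (X x) + card (Y y)"
      by (rule card_Un_le_common[OF XY(1,2) HX(1)[OF xy(1)] HX(2)[OF xy(2)]])
    ultimately have "card (X x \<union> Y y) \<le> card H + 4 * s" using ch(1,2) unfolding ABC by linarith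
    moreover have "N - card (X x \<union> Y y) \<le> card (S e)"
      unfolding S_def e prod.case using diff_card_le_card_Diff[of "X x \<union> Y y" K] XY(1,2) cK by simp
    ultimately show ?thesis using VK(2) unfolding S_def e defs(4) by auto
  qed
  have "finite G" by (rule finite_subset[of _ "V \<times> V"]) (use UV(3) in \<open>auto simp: G_def\<close>)
  then have "\<exists>g. proper G g \<and> (\<forall>e\<in>G. g e \<in> S e)"
    using degr degc lists by (rule galvin_list_colouring)
  then obtain g where g: "proper G g" "\<And>x y. (x, y) \<in> G \<Longrightarrow> g (x, y) \<in> K - (X x \<union> Y y)"
    unfolding S_def by auto
  define f where "f = (\<lambda>(x, y). if (x, y) \<in> G then g (x, y) else THE z. (x, y, z) \<in> P)"
  have fG: "f (x, y) = g (x, y)" if "(x, y) \<in> G" for x y using that by (simp add: f_def)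
  have fP': "f (x, y) = z" if "(x, y, z) \<in> P" for x y z
  proof -
    have "(THE z. (x, y, z) \<in> P) = z"
      using that latin_triples_unique(1)[OF D(1)] by (intro the_equality) auto
    then show ?thesis using that unfolding f_def G_def by auto
  qed
  have cell: "(x, y) \<in> G \<or> (x, y, f (x, y)) \<in> P" if "x \<in> V" "y \<in> V" for x y
    using that fP' unfolding G_def by blast
  have fG': "f (x, y) \<in> K \<and> f (x, y) \<notin> X x \<and> f (x, y) \<notin> Y y" if "(x, y) \<in> G" for x y
    using g(2)[OF that] fG[OF that] by simp
  have f: "proper (V \<times> V) f"
  proof (rule properI)
    fix x y y' assume "(x, y) \<in> V \<times> V" "(x, y') \<in> V \<times> V" and eq: "f (x, y) = f (x, y')"
    then have xy: "(x, y) \<in> G \<or> (x, y, f (x, y)) \<in> P" "(x, y') \<in> G \<or> (x, y', f (x, y)) \<in> P"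
      using cell[of x y] cell[of x y'] by auto
    show "y = y'"
    proof (cases "f (x, y) \<in> X x")
      case True
      then have "(x, y, f (x, y)) \<in> P" "(x, y', f (x, y)) \<in> P"
        using xy fG'[of x y] fG'[of x y'] eq by auto
      then show ?thesis by (rule latin_triples_unique(3)[OF D(1)])
    next
      case False
      then have "(x, y) \<in> G" "(x, y') \<in> G" using xy unfolding inX by blast+
      then show ?thesis using fG eq proper_row[OF g(1), of x y y'] by simp
    qed
  next
    fix x x' y assume "(x, y) \<in> V \<times> V" "(x', y) \<in> V \<times> V" and eq: "f (x, y) = f (x', y)"
    then have xy: "(x, y) \<in> G \<or> (x, y, f (x, y)) \<in> P" "(x', y) \<in> G \<or> (x', y, f (x, y)) \<in> P"
      using cell[of x y] cell[of x' y] by auto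
    show "x = x'"
    proof (cases "f (x, y) \<in> Y y")
      case True
      then have "(x, y, f (x, y)) \<in> P" "(x', y, f (x, y)) \<in> P"
        using xy fG'[of x y] fG'[of x' y] eq by auto
      then show ?thesis by (rule latin_triples_unique(2)[OF D(1)])
    next
      case False
      then have "(x, y) \<in> G" "(x', y) \<in> G" using xy unfolding inY by blast+
      then show ?thesis using fG eq proper_col[OF g(1), of x y x'] by simp
    qed
  qed
  have fK: "f ` (V \<times> V) \<subseteq> K"
  proof (rule image_subsetI)
    fix e assume "e \<in> V \<times> V"
    then obtain x y where e: "e = (x, y)" "x \<in> V" "y \<in> V" by auto
    show "f e \<in> K" using cell[OF e(2,3)] fG[of x y] g(2)[of x y] D(3) VK(1) unfolding e(1) by auto
  qed
  \<comment> \<open>Only the cells of \<open>L\<close> are protected from the swaps. The other cells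
    of \<open>P\<close> may be recoloured: the completed lines have served their purpose once the
    initial filling exists.\<close>
  define L' where "L' = {(x, y). \<exists>z. (x, y, z) \<in> L}"
  have L'V: "L' \<subseteq> V \<times> V" using LU UV(1) unfolding L'_def by auto
  have fL: "f (x, y) = z" if "(x, y, z) \<in> L" for x y z by (rule fP'[OF subsetD[OF D(2) that]])
  have cL': "card L' \<le> card L"
  proof -
    have "L' = (\<lambda>(x, y, z). (x, y)) ` L" unfolding L'_def by force
    then show ?thesis using card_image_le[OF finL] by simp
  qed
  \<comment> \<open>A completed symbol occurs in all \<open>n1\<close> columns. Any other symbol of
    \<open>V\<close> is below the threshold defining \<open>M\<close>, and a symbol outside
    \<open>V\<close> has no cell in \<open>L\<close> at all.\<close>
  have large: "n1 - 10 * s \<le> card (colour_cols (V \<times> V) f c) \<or>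
      (n1 + 10 * s) * card {e \<in> L'. f e = c} + card L' \<le> (10 * s)\<^sup>2" if c: "c \<in> K" for c
  proof (cases "c \<in> H")
    case True
    have "V \<subseteq> colour_cols (V \<times> V) f c"
    proof
      fix y assume y: "y \<in> V"
      then obtain x where "(x, y, c) \<in> P" using fP(3)[OF True] unfolding full_layer_def by auto
      then show "y \<in> colour_cols (V \<times> V) f c"
        using y D(3) fP' unfolding colour_cols_def by blast
    qed
    moreover have "finite (colour_cols (V \<times> V) f c)"
      by (rule finite_subset[OF _ UV(3)]) (auto simp: colour_cols_def)
    ultimately have "card V \<le> card (colour_cols (V \<times> V) f c)" by (intro card_mono)
    then show ?thesis using cV by linarith
  next
    case False
    have "{e \<in> L'. f e = c} \<subseteq> layer (rot (rot L)) c" using fL unfolding L'_def by auto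
    then have "card {e \<in> L'. f e = c} \<le> card (layer (rot (rot L)) c)"
      by (rule card_mono[OF finite_layer[OF finr(2)]])
    then have "(n1 + 10 * s) * card {e \<in> L'. f e = c} + card L' \<le> N * card (layer (rot (rot L)) c) + card L"
      using cL' unfolding defs by (intro add_mono mult_le_mono) auto
    also have "\<dots> \<le> (10 * s)\<^sup>2"
    proof (cases "c \<in> V")
      case True
      then show ?thesis using False unfolding H_def M_def by auto
    next
      case c: False
      then have "layer (rot (rot L)) c = {}" using LU UV(1) unfolding layer_def by auto
      moreover have "s\<^sup>2 \<le> (10 * s)\<^sup>2" by (intro power_mono) auto
      ultimately show ?thesis using cL by simp
    qed
    finally show ?thesis by blast
  qed
  have "10 * s \<le> n1" unfolding n1_def by simp
  from balance_colours[OF UV(3,3) VK(2) cV cV _ this L'V f fK large]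
  obtain h where h: "proper (V \<times> V) h" "h ` (V \<times> V) \<subseteq> K" "\<And>e. e \<in> L' \<Longrightarrow> h e = f e"
    "\<And>c. c \<in> K \<Longrightarrow> n1 - 10 * s \<le> card (colour_cols (V \<times> V) h c)"
    using cK unfolding defs by auto
  have "h (x, y) = z" if "(x, y, z) \<in> L" for x y z
  proof -
    have "(x, y) \<in> L'" using that unfolding L'_def by auto
    then show ?thesis using h(3) fL[OF that] by simp
  qed
  then show thesis using that[of h] h(1,2,4) unfolding defs by simp
qed

theorem theorem1p3:
  shows "\<exists>(C::real) (\<epsilon>::real) (n0::nat). C > 0 \<and> \<epsilon> > 0 \<and> n0 > 0 \<and>
    (\<forall>(n::nat) (L :: nat \<Rightarrow> nat \<Rightarrow> nat option).
       n \<ge> n0 \<longrightarrow> partial_latin_square n L \<longrightarrow>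
       real (num_filled n L) \<le> \<epsilon> * (real n)\<^sup>2 \<longrightarrow>
       (\<exists>(n'::nat) (M :: nat \<Rightarrow> nat \<Rightarrow> nat).
          real n' \<le> real n + C * sqrt (real (num_filled n L)) \<and>
          is_embedding n L n' M))"
proof (rule exI[of _ 50], rule exI[of _ "1 / 2500"], rule exI[of _ 1], intro conjI allI impI)
  fix n :: nat and L :: "nat \<Rightarrow> nat \<Rightarrow> nat option"
  assume pls: "partial_latin_square n L" and few: "real (num_filled n L) \<le> 1/2500 * (real n)\<^sup>2"
  note pls' = pls[unfolded partial_latin_square_def]
  let ?m = "num_filled n L"
  \<comment> \<open>Rounding up costs at most a factor 2, because ?m \<ge> 1 unless \<open>L\<close>
    is empty. So the 25 s added lines number at most 50 sqrt ?m, and \<epsilon> = 1/2500 gives sqrt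
    ?m \<le> n / 50, that is 25 s \<le> n.\<close>
  define s where "s = nat \<lceil>sqrt (real ?m)\<rceil>"
  define T where "T = {(i, j, k). i \<in> {1..n} \<and> j \<in> {1..n} \<and> L i j = Some k}"
  have le_s: "sqrt (real ?m) \<le> real s" unfolding s_def by linarith
  have s_le: "real s \<le> 2 * sqrt (real ?m)"
  proof (cases "?m = 0")
    case True
    then show ?thesis by (simp add: s_def)
  next
    case False
    then have "1 \<le> sqrt (real ?m)" by simp
    moreover have "real s = of_int \<lceil>sqrt (real ?m)\<rceil>" unfolding s_def by simp
    then have "real s \<le> sqrt (real ?m) + 1" using of_int_ceiling_le_add_one by metis
    ultimately show ?thesis by linarith
  qed
  have "sqrt (real ?m) \<le> sqrt ((real n / 50)\<^sup>2)"
    using few by (intro real_sqrt_le_mono) (simp add: power_divide)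
  then have sn: "25 * s \<le> n" using s_le by simp
  have "real ?m \<le> (real s)\<^sup>2" by (rule sqrt_le_D[OF le_s])
  then have ms: "?m \<le> s\<^sup>2" by (simp flip: of_nat_power)
  have val: "k \<in> {1..n}" if "(i, j, k) \<in> T" for i j k
  proof -
    have ij: "i \<in> {1..n}" "j \<in> {1..n}" "L i j = Some k" using that unfolding T_def by auto
    have "L i j \<in> insert None (Some ` {1..n})" using pls' ij(1,2) by simp
    then show ?thesis unfolding ij(3) by auto
  qed
  have TU: "T \<subseteq> {1..n} \<times> {1..n} \<times> {1..n}"
  proof
    fix e assume e: "e \<in> T"
    obtain i j k where ijk: "e = (i, j, k)" by (cases e)
    have "i \<in> {1..n}" "j \<in> {1..n}" using e unfolding ijk T_def by auto
    moreover have "k \<in> {1..n}" by (rule val) (use e ijk in simp)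
    ultimately show "e \<in> {1..n} \<times> {1..n} \<times> {1..n}" unfolding ijk by blast
  qed
  have "latin_triples T"
    unfolding latin_triples_def
  proof (intro conjI allI impI)
    fix x y z z' assume "(x, y, z) \<in> T" "(x, y, z') \<in> T"
    then show "z = z'" unfolding T_def by simp
  next
    fix y z x x' assume a: "(x, y, z) \<in> T" "(x', y, z) \<in> T"
    then have "y \<in> {1..n}" "z \<in> {1..n}" using TU by auto
    then have "\<exists>\<^sub>\<le>\<^sub>1i. i \<in> {1..n} \<and> L i y = Some z" using pls' by simp
    then show "x = x'" using a unfolding T_def by (auto dest: Uniq_D)
  next
    fix z x y y' assume a: "(x, y, z) \<in> T" "(x, y', z) \<in> T"
    then have "x \<in> {1..n}" "z \<in> {1..n}" using TU by auto
    then have "\<exists>\<^sub>\<le>\<^sub>1j. j \<in> {1..n} \<and> L x j = Some z" using pls' by simp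
    then show "y = y'" using a unfolding T_def by (auto dest: Uniq_D)
  qed
  moreover have "card T \<le> s\<^sup>2"
  proof -
    let ?F = "{(i, j). i \<in> {1..n} \<and> j \<in> {1..n} \<and> L i j \<noteq> None}"
    have "finite ?F" by (rule finite_subset[of _ "{1..n} \<times> {1..n}"]) auto
    then have "card T \<le> card ?F"
      by (intro card_inj_on_le[of "\<lambda>(i, j, k). (i, j)"]) (auto simp: T_def inj_on_def)
    then show ?thesis using ms unfolding num_filled_def by simp
  qed
  ultimately obtain f where f:
    "proper ({1..n + 15 * s} \<times> {1..n + 15 * s}) f"
    "f ` ({1..n + 15 * s} \<times> {1..n + 15 * s}) \<subseteq> {1..n + 15 * s + 10 * s}"
    "\<And>x y z. (x, y, z) \<in> T \<Longrightarrow> f (x, y) = z"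
    "\<And>c. c \<in> {1..n + 15 * s + 10 * s} \<Longrightarrow>
      n + 15 * s - 10 * s \<le> card (colour_cols ({1..n + 15 * s} \<times> {1..n + 15 * s}) f c)"
    using balanced_filling[OF _ TU _ sn] by blast
  obtain M where M: "latin_square (n + 15 * s + 10 * s) M"
    "\<And>i j. i \<in> {1..n + 15 * s} \<Longrightarrow> j \<in> {1..n + 15 * s} \<Longrightarrow> M i j = f (i, j)"
    using ryser_embedding[OF f(1,2,4)] by blast
  have "L i j = Some (M i j)" if ij: "i \<in> {1..n}" "j \<in> {1..n}" "L i j \<noteq> None" for i j
  proof -
    obtain k where k: "L i j = Some k" using ij(3) by blast
    then have "f (i, j) = k" using ij by (intro f(3)) (simp add: T_def)
    then show ?thesis using M(2)[of i j] ij k by simp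
  qed
  then have "is_embedding n L (n + 15 * s + 10 * s) M" using M(1) unfolding is_embedding_def by auto
  moreover have "real (n + 15 * s + 10 * s) \<le> real n + 50 * sqrt (real ?m)" using s_le by simp
  ultimately show "\<exists>n' M. real n' \<le> real n + 50 * sqrt (real ?m) \<and> is_embedding n L n' M" by blast
qed simp_all

end
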